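(* Let $K\subset\mathbb{R}^2$ be a (non-degenerate) parallelogram, let $\mathbb{X}_\square(K)=\operatorname{sym}(\boldsymbol Q^0(K)\otimes\boldsymbol{RT}^1(K))$ and $\mathbb{X}_\triangle(K)=\operatorname{sym}(\boldsymbol{RT}^0(K)\otimes\boldsymbol{RT}^1(K))$. Then: (a) $\widehat{\boldsymbol M}\in\mathbb{X}_\square(\widehat K)$ if and only if $\mathcal{H}_K(\widehat{\boldsymbol M})\in\mathbb{X}_\square(K)$; (b) $\mathbb{X}_\square(K)=\mathbb{X}_\triangle(K)\oplus\mathcal{H}_K(\widetilde{\mathbb{P}}^3(\widehat K))=\mathbb{P}^1_{\mathrm{sym}}(K)\oplus\widetilde{\mathbb{P}}^2(K)\oplus\mathcal{H}_K(\widetilde{\mathbb{P}}^3(\widehat K))\oplus\boldsymbol x\boldsymbol x^\top P^1(K)$; (c) $\dim(\mathbb{X}_\square(K))=20$; (d) $\mathbb{P}^1_{\mathrm{sym}}(K)\subseteq\mathbb{X}_\triangle(K)\subseteq\mathbb{X}_\square(K)\subseteq\mathbb{P}^3_{\mathrm{sym}}(K)$; (e) $\operatorname{div}\mathbf{div}(\mathbb{X}_\square(K))=P^1(K)$; (f) $\boldsymbol n\cdot\boldsymbol M\boldsymbol n|_E\in P^1(E)$ for all edges $E$ of $K$ and all $\boldsymbol M\in\mathbb{X}_\square(K)$; (g) $(\boldsymbol n\cdot\mathbf{div}\boldsymbol M+\partial_{\boldsymbol t}(\boldsymbol t\cdot\boldsymbol M\boldsymbol n))|_E\in P^1(E)$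 for all edges $E$ of $K$ and all $\boldsymbol M\in\mathbb{X}_\square(K)$.
   Context: $P^p(K)$, $P^p(E)$: polynomials of (total) degree $\le p$ on $K$, on an edge $E$; $P^p_{\mathrm{hom}}(K)$: homogeneous polynomials of degree $p$; $\boldsymbol P^p(K)=P^p(K)^2$; $\mathbb{P}^p_{\mathrm{sym}}(K)$: symmetric $2\times2$ tensors with entries in $P^p(K)$. $\boldsymbol x$ denotes the function $(x,y)\mapsto(x,y)^\top$. $\boldsymbol{RT}^p(K)=\boldsymbol P^p(K)\oplus\boldsymbol xP^p_{\mathrm{hom}}(K)$ (also for parallelograms). $\operatorname{sym}(\boldsymbol M)=\frac12(\boldsymbol M+\boldsymbol M^\top)$ (applied to spaces: image). $\boldsymbol X\otimes\boldsymbol Y=\operatorname{span}\{\boldsymbol\phi\boldsymbol\psi^\top:\boldsymbol\phi\in\boldsymbol X,\boldsymbol\psi\in\boldsymbol Y\}$. $\boldsymbol x\boldsymbol x^\top P^1(K)=\{\boldsymbol x\boldsymbol x^\top\eta:\eta\in P^1(K)\}$. $\mathbf{Curl}\,\boldsymbol q$ has rows $(\partial_yq_i,-\partial_xq_i)$, $\mathbf{sCurl}\,\boldsymbol q=\operatorname{sym}(\mathbf{Curl}\,\boldsymbol q)$, $\widetilde{\mathbb{P}}^2(K)=\mathbf{sCurl}(P^2_{\mathrm{hom}}(K)\boldsymbol x)$. $\mathbf{div}$ is the row-wise divergence, $\operatorname{div}\mathbf{div}$ the iterated divergence. $\widehat K=(0,1)^2$ is the reference square with vertices $(0,0),(1,0),(1,1),(0,1)$.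 For $K$ with vertices $\boldsymbol a_K,\boldsymbol b_K,\boldsymbol d_K,\boldsymbol c_K$ in positive order, $F_K(\widehat{\boldsymbol x})=\boldsymbol B_K\widehat{\boldsymbol x}+\boldsymbol a_K$, $\boldsymbol B_K=(\boldsymbol b_K-\boldsymbol a_K\;\;\boldsymbol c_K-\boldsymbol a_K)$. Piola transformation: $\boldsymbol\phi=\mathcal{P}_K(\widehat{\boldsymbol\phi})$ with $\det(\boldsymbol B_K)\,\boldsymbol\phi\circ F_K=\boldsymbol B_K\widehat{\boldsymbol\phi}$. Piola–Kirchhoff transformation: $\boldsymbol M=\mathcal{H}_K(\widehat{\boldsymbol M})$ with $\det(\boldsymbol B_K)\,\boldsymbol M\circ F_K=\boldsymbol B_K\widehat{\boldsymbol M}\boldsymbol B_K^\top$ (symmetric tensor fields). $\boldsymbol Q^0(\widehat K)=\boldsymbol P^0(\widehat K)\oplus\operatorname{span}\{(x,0)^\top,(0,y)^\top\}$ and $\boldsymbol Q^0(K)=\mathcal{P}_K(\boldsymbol Q^0(\widehat K))$. $\widetilde{\mathbb{P}}^3(\widehat K)$ is the span of $$\begin{pmatrix} x^2 & xy \\ xy & -2y^2 \end{pmatrix},\ \begin{pmatrix} 0 & y^2 \\ y^2 & 0 \end{pmatrix},\ \begin{pmatrix} 0 & 0 \\ 0 & xy \end{pmatrix},\ \begin{pmatrix} 2x^3 & -x^2y \\ -x^2y & -4xy^2 \end{pmatrix},\ \begin{pmatrix} 4x^2y & xy^2 \\ xy^2 & -2y^3 \end{pmatrix}.$$ $\boldsymbol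 n$, $\boldsymbol t$: unit exterior normal and unit tangent (positive orientation) along $\partial K$; $\partial_{\boldsymbol t}$: tangential derivative along an edge. *)

theory Defs
  imports "HOL-Analysis.Analysis" "HOL-Library.Function_Algebras"
begin

text \<open>Pointwise scalar multiplication makes functions into a real vector space, so that the
  library constants \<open>span\<close>, \<open>subspace\<close> and \<open>dim\<close> apply to spaces of fields.\<close>

instantiation "fun" :: (type, real_vector) real_vector
begin

definition scaleR_fun_def: "scaleR c f = (\<lambda>x. scaleR c (f x))"

instance
  by standard (simp_all add: scaleR_fun_def fun_eq_iff scaleR_add_right scaleR_add_left)

end

text \<open>Internal direct sum of a list of subspaces: every element of \<open>V\<close> has exactly one
  representation as a sum with one summand from each member of the list.\<close>

definition is_direct_sum :: "'a::real_vector set \<Rightarrow> 'a set list \<Rightarrow> bool" where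
  "is_direct_sum V Us \<longleftrightarrow> (\<forall>U\<in>set Us. subspace U) \<and> bij_betw sum_list (listset Us) V"


section \<open>Parallelograms\<close>

datatype quad = Quad (vert_a: "real^2") (vert_b: "real^2") (vert_d: "real^2") (vert_c: "real^2")

definition B_mat :: "quad \<Rightarrow> real^2^2" where
  "B_mat T = (\<chi> i j. if j = 1 then (vert_b T - vert_a T) $ i else (vert_c T - vert_a T) $ i)"

definition F_map :: "quad \<Rightarrow> real^2 \<Rightarrow> real^2" where
  "F_map T x = B_mat T *v x + vert_a T"

text \<open>The vertices are listed in the order \<open>a, b, d, c\<close>; a positive determinant says that the
  parallelogram is non-degenerate and that this order is counterclockwise.\<close>

definition is_parallelogram :: "quad \<Rightarrow> bool" where
  "is_parallelogram T \<longleftrightarrow> vert_d T - vert_c T = vert_b T - vert_a T \<and> det (B_mat T) > 0"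

definition region :: "quad \<Rightarrow> (real^2) set" where
  "region T = interior (convex hull {vert_a T, vert_b T, vert_d T, vert_c T})"

definition unit_square :: quad where
  "unit_square = Quad (vector [0, 0]) (vector [1, 0]) (vector [1, 1]) (vector [0, 1])"

text \<open>Edges are given by their endpoints, oriented along the positive boundary orientation. Hence
  the exterior normal is the tangent rotated clockwise by a right angle.\<close>

definition edges :: "quad \<Rightarrow> ((real^2) \<times> (real^2)) set" where
  "edges T = {(vert_a T, vert_b T), (vert_b T, vert_d T), (vert_d T, vert_c T), (vert_c T, vert_a T)}"

definition tangent :: "(real^2) \<times> (real^2) \<Rightarrow> real^2" where
  "tangent e = (snd e - fst e) /\<^sub>R norm (snd e - fst e)"

definition normal :: "(real^2) \<times> (real^2) \<Rightarrow> real^2" where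
  "normal e = vector [tangent e $ 2, - tangent e $ 1]"

text \<open>The relative interior of the edge: there the tangential derivative along the edge is an
  ordinary two-sided derivative.\<close>

definition edge_set :: "(real^2) \<times> (real^2) \<Rightarrow> (real^2) set" where
  "edge_set e = open_segment (fst e) (snd e)"


section \<open>Polynomial spaces\<close>

text \<open>A function on a set \<open>S\<close> is represented by its extension by zero outside \<open>S\<close>, so that
  equality of representatives is equality on \<open>S\<close>.\<close>

definition on :: "'a set \<Rightarrow> ('a \<Rightarrow> 'b::zero) \<Rightarrow> 'a \<Rightarrow> 'b" where
  "on S f = (\<lambda>x. if x \<in> S then f x else 0)"

text \<open>For an edge \<open>S\<close>, restrictions to \<open>S\<close> of bivariate polynomials of total degree at most \<open>p\<close>
  are exactly the polynomials of degree at most \<open>p\<close> in the arc length.\<close>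

definition Pol :: "nat \<Rightarrow> (real^2) set \<Rightarrow> (real^2 \<Rightarrow> real) set" where
  "Pol p S = span {on S (\<lambda>x. x$1 ^ i * x$2 ^ j) | i j. i + j \<le> p}"

definition Pol_hom :: "nat \<Rightarrow> (real^2) set \<Rightarrow> (real^2 \<Rightarrow> real) set" where
  "Pol_hom p S = span {on S (\<lambda>x. x$1 ^ i * x$2 ^ j) | i j. i + j = p}"

definition Pol_vec :: "nat \<Rightarrow> (real^2) set \<Rightarrow> (real^2 \<Rightarrow> real^2) set" where
  "Pol_vec p S = {\<phi>. \<forall>i. (\<lambda>x. \<phi> x $ i) \<in> Pol p S}"

definition Pol_sym :: "nat \<Rightarrow> (real^2) set \<Rightarrow> (real^2 \<Rightarrow> real^2^2) set" where
  "Pol_sym p S = {M. (\<forall>i j. (\<lambda>x. M x $ i $ j) \<in> Pol p S) \<and> (\<forall>x. transpose (M x) = M x)}"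

text \<open>The sums in \<open>RT\<close> and \<open>Q0_ref\<close> are sums of sets of fields; they are direct when \<open>S\<close> has
  non-empty interior, since the non-zero fields in the second summand have higher degree than those
  in the first one.\<close>

definition RT :: "nat \<Rightarrow> (real^2) set \<Rightarrow> (real^2 \<Rightarrow> real^2) set" where
  "RT p S = {\<phi> + (\<lambda>x. \<eta> x *\<^sub>R x) | \<phi> \<eta>. \<phi> \<in> Pol_vec p S \<and> \<eta> \<in> Pol_hom p S}"

definition Q0_ref :: "(real^2 \<Rightarrow> real^2) set" where
  "Q0_ref = {\<phi> + \<psi> | \<phi> \<psi>. \<phi> \<in> Pol_vec 0 (region unit_square) \<and>
     \<psi> \<in> span {on (region unit_square) (\<lambda>x. vector [x$1, 0]),
                on (region unit_square) (\<lambda>x. vector [0, x$2])}}"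


section \<open>Transformations\<close>

definition piola :: "quad \<Rightarrow> (real^2 \<Rightarrow> real^2) \<Rightarrow> real^2 \<Rightarrow> real^2" where
  "piola T \<phi> = on (region T)
     (\<lambda>x. (1 / det (B_mat T)) *\<^sub>R (B_mat T *v \<phi> (inv (F_map T) x)))"

definition piola_kirchhoff :: "quad \<Rightarrow> (real^2 \<Rightarrow> real^2^2) \<Rightarrow> real^2 \<Rightarrow> real^2^2" where
  "piola_kirchhoff T M = on (region T)
     (\<lambda>x. (1 / det (B_mat T)) *\<^sub>R (B_mat T ** M (inv (F_map T) x) ** transpose (B_mat T)))"

definition sym_fields :: "(real^2) set \<Rightarrow> (real^2 \<Rightarrow> real^2^2) set" where
  "sym_fields S = {M. (\<forall>x. transpose (M x) = M x) \<and> (\<forall>x. x \<notin> S \<longrightarrow> M x = 0)}"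

definition Q0 :: "quad \<Rightarrow> (real^2 \<Rightarrow> real^2) set" where
  "Q0 T = piola T ` Q0_ref"


section \<open>Differential operators and traces\<close>

definition dir_deriv :: "real^2 \<Rightarrow> (real^2 \<Rightarrow> real) \<Rightarrow> real^2 \<Rightarrow> real" where
  "dir_deriv v f x = deriv (\<lambda>s. f (x + s *\<^sub>R v)) 0"

abbreviation partial :: "2 \<Rightarrow> (real^2 \<Rightarrow> real) \<Rightarrow> real^2 \<Rightarrow> real" where
  "partial k \<equiv> dir_deriv (axis k 1)"

text \<open>The operators below act on fields on an open set \<open>S\<close>.\<close>

definition Curl :: "(real^2) set \<Rightarrow> (real^2 \<Rightarrow> real^2) \<Rightarrow> real^2 \<Rightarrow> real^2^2" where
  "Curl S q = on S (\<lambda>x. \<chi> i j. if j = 1 then partial 2 (\<lambda>y. q y $ i) x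
                              else - partial 1 (\<lambda>y. q y $ i) x)"

definition divergence :: "(real^2) set \<Rightarrow> (real^2 \<Rightarrow> real^2) \<Rightarrow> real^2 \<Rightarrow> real" where
  "divergence S \<phi> = on S (\<lambda>x. \<Sum>j\<in>UNIV. partial j (\<lambda>y. \<phi> y $ j) x)"

definition row_div :: "(real^2) set \<Rightarrow> (real^2 \<Rightarrow> real^2^2) \<Rightarrow> real^2 \<Rightarrow> real^2" where
  "row_div S M = (\<lambda>x. \<chi> i. divergence S (\<lambda>y. M y $ i) x)"

definition div_div :: "(real^2) set \<Rightarrow> (real^2 \<Rightarrow> real^2^2) \<Rightarrow> real^2 \<Rightarrow> real" where
  "div_div S M = divergence S (row_div S M)"

text \<open>Boundary values of a function defined on the open set \<open>S\<close>. They exist for all functions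
  that occur here, which are polynomials on \<open>S\<close>.\<close>

definition trace_of :: "(real^2) set \<Rightarrow> (real^2 \<Rightarrow> real) \<Rightarrow> real^2 \<Rightarrow> real" where
  "trace_of S f x = Lim (at x within S) f"


section \<open>Tensor spaces\<close>

definition sym_part :: "real^2^2 \<Rightarrow> real^2^2" where
  "sym_part M = (1/2) *\<^sub>R (M + transpose M)"

definition sym_space :: "(real^2 \<Rightarrow> real^2^2) set \<Rightarrow> (real^2 \<Rightarrow> real^2^2) set" where
  "sym_space V = (\<lambda>M. sym_part \<circ> M) ` V"

definition outer :: "real^2 \<Rightarrow> real^2 \<Rightarrow> real^2^2" where
  "outer u v = (\<chi> i j. u $ i * v $ j)"

definition tensor_space ::
  "(real^2 \<Rightarrow> real^2) set \<Rightarrow> (real^2 \<Rightarrow> real^2) set \<Rightarrow> (real^2 \<Rightarrow> real^2^2) set" where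
  "tensor_space X Y = span {(\<lambda>x. outer (\<phi> x) (\<psi> x)) | \<phi> \<psi>. \<phi> \<in> X \<and> \<psi> \<in> Y}"

definition sCurl :: "(real^2) set \<Rightarrow> (real^2 \<Rightarrow> real^2) \<Rightarrow> real^2 \<Rightarrow> real^2^2" where
  "sCurl S q = sym_part \<circ> Curl S q"

definition P2_tilde :: "(real^2) set \<Rightarrow> (real^2 \<Rightarrow> real^2^2) set" where
  "P2_tilde S = sCurl S ` {(\<lambda>x. \<eta> x *\<^sub>R x) | \<eta>. \<eta> \<in> Pol_hom 2 S}"

definition P3_tilde_ref :: "(real^2 \<Rightarrow> real^2^2) set" where
  "P3_tilde_ref = span (on (region unit_square) `
    {\<lambda>x. vector [vector [x$1^2, x$1 * x$2], vector [x$1 * x$2, - 2 * x$2^2]],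
     \<lambda>x. vector [vector [0, x$2^2], vector [x$2^2, 0]],
     \<lambda>x. vector [vector [0, 0], vector [0, x$1 * x$2]],
     \<lambda>x. vector [vector [2 * x$1^3, - (x$1^2 * x$2)], vector [- (x$1^2 * x$2), - 4 * x$1 * x$2^2]],
     \<lambda>x. vector [vector [4 * x$1^2 * x$2, x$1 * x$2^2], vector [x$1 * x$2^2, - 2 * x$2^3]]})"

definition xxT_P1 :: "(real^2) set \<Rightarrow> (real^2 \<Rightarrow> real^2^2) set" where
  "xxT_P1 S = {(\<lambda>x. \<eta> x *\<^sub>R outer x x) | \<eta>. \<eta> \<in> Pol 1 S}"

definition X_square :: "quad \<Rightarrow> (real^2 \<Rightarrow> real^2^2) set" where
  "X_square T = sym_space (tensor_space (Q0 T) (RT 1 (region T)))"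

definition X_triangle :: "quad \<Rightarrow> (real^2 \<Rightarrow> real^2^2) set" where
  "X_triangle T = sym_space (tensor_space (RT 0 (region T)) (RT 1 (region T)))"


section \<open>Consistency of the conventions\<close>

lemma B_mat_mult: "B_mat T *v x = x$1 *\<^sub>R (vert_b T - vert_a T) + x$2 *\<^sub>R (vert_c T - vert_a T)"
  by (simp add: B_mat_def vec_eq_iff matrix_vector_mult_def sum_2 algebra_simps)

lemma is_parallelogram_unit_square: "is_parallelogram unit_square"
  by (simp add: is_parallelogram_def unit_square_def B_mat_def det_2 vec_eq_iff forall_2)

lemma F_map_unit_square: "F_map unit_square = id"
  by (simp add: fun_eq_iff F_map_def B_mat_mult unit_square_def vec_eq_iff forall_2)

lemma bij_F_map: "is_parallelogram T \<Longrightarrow> bij (F_map T)"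
proof -
  assume "is_parallelogram T"
  then have "invertible (B_mat T)" by (simp add: is_parallelogram_def invertible_det_nz)
  then have "bij ((*v) (B_mat T))"
    using invertible_eq_bij by blast
  then have "bij ((\<lambda>y. y + vert_a T) \<circ> (*v) (B_mat T))"
    by (intro bij_comp) (auto intro!: o_bij[of "\<lambda>y. y - vert_a T"])
  then show ?thesis by (simp add: F_map_def[abs_def] comp_def)
qed

lemma region_unit_square: "region unit_square = {x. 0 < x$1 \<and> x$1 < 1 \<and> 0 < x$2 \<and> x$2 < 1}"
proof -
  let ?V = "{vector [0,0], vector [1,0], vector [1,1], vector [0,1]} :: (real^2) set"
  have "convex hull ?V = (cbox 0 1 :: (real^2) set)" (is "?H = ?C")
  proof
    show "?H \<subseteq> ?C"
      by (rule hull_minimal)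
        (auto simp: mem_box_cart forall_2 convex_box)
    show "?C \<subseteq> ?H"
    proof
      fix x :: "real^2" assume "x \<in> ?C"
      then have x: "0 \<le> x$1" "x$1 \<le> 1" "0 \<le> x$2" "x$2 \<le> 1"
        by (auto simp: mem_box_cart forall_2)
      let ?p = "\<lambda>s. (1 - x$1) *\<^sub>R vector [0,s] + x$1 *\<^sub>R vector [1,s] :: real^2"
      have "?V \<subseteq> ?H" by (rule hull_subset)
      then have "?p 0 \<in> ?H" "?p 1 \<in> ?H"
        using x by (auto intro: convexD[OF convex_convex_hull])
      then have "(1 - x$2) *\<^sub>R ?p 0 + x$2 *\<^sub>R ?p 1 \<in> ?H"
        using x by (auto intro: convexD[OF convex_convex_hull])
      moreover have "(1 - x$2) *\<^sub>R ?p 0 + x$2 *\<^sub>R ?p 1 = x"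
        by (simp add: vec_eq_iff forall_2 algebra_simps)
      ultimately show "x \<in> ?H" by simp
    qed
  qed
  then show ?thesis
    by (auto simp: region_def unit_square_def interior_cbox mem_box_cart forall_2)
qed

lemma region_eq_F_map:
  assumes "is_parallelogram T"
  shows "region T = F_map T ` region unit_square"
proof -
  let ?V = "{vector [0,0], vector [1,0], vector [1,1], vector [0,1]} :: (real^2) set"
  have inj: "inj ((*v) (B_mat T))"
    using assms by (metis invertible_det_nz is_parallelogram_def less_irrefl inj_matrix_vector_mult)
  have F: "F_map T ` S = (\<lambda>y. vert_a T + y) ` ((*v) (B_mat T) ` S)" for S
    by (auto simp: F_map_def image_image add.commute)
  have V: "F_map T ` ?V = {vert_a T, vert_b T, vert_d T, vert_c T}"
    using assms by (auto simp: F_map_def B_mat_mult is_parallelogram_def algebra_simps)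
  have "F_map T ` region unit_square = interior (F_map T ` (convex hull ?V))"
    unfolding region_def F
    by (simp add: unit_square_def interior_translation
        interior_injective_linear_image[OF matrix_vector_mul_linear inj])
  also have "F_map T ` (convex hull ?V) = convex hull (F_map T ` ?V)"
    unfolding F by (simp only: convex_hull_linear_image[OF matrix_vector_mul_linear]
        convex_hull_translation)
  finally show ?thesis unfolding V by (simp add: region_def)
qed

lemma piola_kirchhoff_F_map:
  assumes "is_parallelogram T" "x \<in> region unit_square"
  shows "det (B_mat T) *\<^sub>R piola_kirchhoff T M (F_map T x) = B_mat T ** M x ** transpose (B_mat T)"
  using assms bij_F_map[OF assms(1)]
  by (simp add: piola_kirchhoff_def on_def region_eq_F_map bij_is_inj is_parallelogram_def)

lemma Q0_unit_square: "Q0 unit_square = Q0_ref"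
proof -
  have "B_mat unit_square = mat 1"
    by (simp add: B_mat_def unit_square_def mat_def vec_eq_iff forall_2)
  then have P: "piola unit_square \<phi> = on (region unit_square) \<phi>" for \<phi>
    by (simp add: piola_def F_map_unit_square on_def fun_eq_iff)
  have van: "f x = 0" if "f \<in> span G" "\<And>g. g \<in> G \<Longrightarrow> g x = 0"
    for f :: "real^2 \<Rightarrow> 'b::real_vector" and G x
    using that by (induction rule: span_induct_alt) (auto simp: scaleR_fun_def)
  have "\<phi> x = 0" if "\<phi> \<in> Q0_ref" "x \<notin> region unit_square" for \<phi> x
  proof -
    from that(1) obtain f g where fg: "\<phi> = f + g" "f \<in> Pol_vec 0 (region unit_square)"
      "g \<in> span {on (region unit_square) (\<lambda>x. vector [x$1, 0]),
                on (region unit_square) (\<lambda>x. vector [0, x$2])}"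
      unfolding Q0_ref_def by blast
    have "g x = 0" using fg(3) that(2) by (elim van) (auto simp: on_def)
    moreover have "f x $ i = 0" for i
      using fg(2) that(2) van[of "\<lambda>x. f x $ i" _ x]
      by (force simp: Pol_vec_def Pol_def on_def)
    ultimately show ?thesis using fg(1) by (simp add: vec_eq_iff)
  qed
  then have "on (region unit_square) \<phi> = \<phi>" if "\<phi> \<in> Q0_ref" for \<phi>
    using that by (auto simp: on_def fun_eq_iff)
  then show ?thesis by (auto simp: Q0_def P image_iff)
qed

lemma normal_exterior:
  assumes "is_parallelogram T" "e \<in> edges T" "x \<in> region T"
  shows "normal e \<bullet> (x - fst e) < 0"
proof -
  obtain y where y: "x = F_map T y" "0 < y$1" "y$1 < 1" "0 < y$2" "y$2 < 1"
    using assms(1,3) by (auto simp: region_eq_F_map region_unit_square)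
  define u v where "u = vert_b T - vert_a T" and "v = vert_c T - vert_a T"
  have d: "u$1 * v$2 - u$2 * v$1 > 0"
    using assms(1) by (simp add: is_parallelogram_def B_mat_def det_2 u_def v_def algebra_simps)
  have vd: "vert_b T = vert_a T + u" "vert_c T = vert_a T + v" "vert_d T = vert_a T + u + v"
    using assms(1) by (auto simp: is_parallelogram_def u_def v_def algebra_simps)
  have x: "x = vert_a T + y$1 *\<^sub>R u + y$2 *\<^sub>R v"
    using y(1) by (simp add: F_map_def B_mat_mult u_def v_def)
  have uv: "norm u > 0" "norm v > 0" using d by auto
  have n: "normal e \<bullet> w = ((snd e - fst e)$2 * w$1 - (snd e - fst e)$1 * w$2) / norm (snd e - fst e)" for w
    by (simp add: normal_def tangent_def inner_vec_def sum_2 divide_inverse algebra_simps)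
  let ?d = "u$1 * v$2 - u$2 * v$1"
  have pos: "y$1 * ?d > 0" "y$2 * ?d > 0" "(1 - y$1) * ?d > 0" "(1 - y$2) * ?d > 0"
    using y d by simp_all
  show ?thesis
    using assms(2) uv pos unfolding n edges_def x
    by (auto simp: vd divide_less_0_iff norm_minus_commute algebra_simps)
qed

end

theory Submission
  imports Defs
begin

text \<open>All spaces in the statement consist of restrictions to \<open>K\<close> of polynomial fields on the whole
  plane, and a polynomial that vanishes on a non-empty open set is zero. So restriction to \<open>K\<close>, a
  linear map, is injective on polynomial fields, and every assertion about dimensions and direct sums
  may be proved for global fields (those with domain \<open>UNIV\<close>).

  For global fields, the Piola transformation maps \<open>RT 0\<close> and \<open>RT 1\<close> onto themselves, because the
  position vector is mapped to a multiple of the position vector plus a constant. The product of two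
  Piola transforms is, up to the factor \<open>det B\<close>, the Piola--Kirchhoff transform of the product.
  Hence the triangle space is invariant under the Piola--Kirchhoff transformation \<open>H\<close>, and the
  square space of \<open>K\<close> is the image under \<open>H\<close> of that of the reference square
  (\<open>X_square_eq_on\<close>, \<open>kirchhoff_global_X_triangle\<close>); this gives (a).

  For (b) and (c) it then suffices to decompose two spaces. A product of an \<open>RT 0\<close> and an \<open>RT 1\<close> field
  is the sum of a symmetric affine tensor, a symmetric product \<open>sym (x \<chi>^T)\<close> with linear \<open>\<chi>\<close>, and a
  term \<open>x x^T \<eta>\<close>; since \<open>\<chi>\<close> is a multiple of \<open>x\<close> plus the curl of a quadratic form, this is the
  decomposition of the triangle space. On the reference square only the products of \<open>(x, - y)\<close> with
  \<open>RT 1\<close> are new, and these are absorbed by the five extra generators. Comparing the coefficients of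
  the entries shows that the twenty parameters are independent (\<open>fields_independent\<close>).

  For (e), \<open>div div\<close> lowers the degree by two, and it maps \<open>x x^T (a + b x + c y)\<close> to
  \<open>6 a + 12 b x + 12 c y\<close>.

  For (f) and (g), a first factor in physical coordinates has the form \<open>\<phi> x = w + A x\<close>, where the edge
  directions are eigenvectors of \<open>A\<close>. Let \<open>t\<close> and \<open>n\<close> be the tangent and normal of an edge. Then \<open>n\<close> is
  an eigenvector of the transpose of \<open>A\<close>, so \<open>n \<bullet> \<phi>\<close> is constant along the edge, as is \<open>n \<bullet> x\<close>. For
  \<open>\<psi> x = c + C x + (h \<bullet> x) x\<close> this makes \<open>n \<bullet> \<psi>\<close> affine along the edge, and in the product rule for
  \<open>n \<bullet> div M + \<partial>\<^sub>t (t \<bullet> M n)\<close> every summand has at most one affine factor that is not constant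
  (\<open>edge_trace_generator\<close>).\<close>

section \<open>Direct sums of lists of subspaces\<close>

lemma listset_minus:
  assumes "\<forall>U\<in>set Us. subspace U" "us \<in> listset Us" "vs \<in> listset Us"
  shows "map2 (-) us vs \<in> listset Us" "sum_list (map2 (-) us vs) = sum_list us - sum_list vs"
    "set (map2 (-) us vs) \<subseteq> {0} \<Longrightarrow> us = vs"
proof -
  have "map2 (-) us vs \<in> listset Us \<and> sum_list (map2 (-) us vs) = sum_list us - sum_list vs
    \<and> (set (map2 (-) us vs) \<subseteq> {0} \<longrightarrow> us = vs)"
    using assms
  proof (induction Us arbitrary: us vs)
    case (Cons U Us)
    obtain u us' where u: "us = u # us'" "u \<in> U" "us' \<in> listset Us"
      using Cons.prems(2) by (auto simp: set_Cons_def)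
    obtain v vs' where v: "vs = v # vs'" "v \<in> U" "vs' \<in> listset Us"
      using Cons.prems(3) by (auto simp: set_Cons_def)
    have "\<forall>U\<in>set Us. subspace U" "u - v \<in> U"
      using Cons.prems(1) u v by (auto intro: subspace_diff)
    then show ?case using Cons.IH[OF _ u(3) v(3)] by (simp add: u(1) v(1) set_Cons_def)
  qed simp
  then show "map2 (-) us vs \<in> listset Us"
    "sum_list (map2 (-) us vs) = sum_list us - sum_list vs"
    "set (map2 (-) us vs) \<subseteq> {0} \<Longrightarrow> us = vs"
    by blast+
qed

lemma zeros_in_listset:
  assumes "\<forall>U\<in>set Us. subspace U"
  shows "map (\<lambda>_. 0) Us \<in> listset Us"
  using assms by (induction Us) (auto simp: set_Cons_def subspace_0)

text \<open>By linearity, two representations of the same element differ by a representation of zero, so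
  uniqueness needs to be checked for zero only.\<close>
lemma is_direct_sum_iff:
  "is_direct_sum V Us \<longleftrightarrow> (\<forall>U\<in>set Us. subspace U) \<and> V = sum_list ` listset Us \<and>
     (\<forall>us\<in>listset Us. sum_list us = 0 \<longrightarrow> set us \<subseteq> {0})"
proof (cases "\<forall>U\<in>set Us. subspace U")
  case sub: True
  have "inj_on sum_list (listset Us) \<longleftrightarrow>
    (\<forall>us\<in>listset Us. sum_list us = 0 \<longrightarrow> set us \<subseteq> {0})"
  proof
    assume inj: "inj_on sum_list (listset Us)"
    show "\<forall>us\<in>listset Us. sum_list us = 0 \<longrightarrow> set us \<subseteq> {0}"
    proof (intro ballI impI)
      fix us assume us: "us \<in> listset Us" "sum_list us = 0"
      have "sum_list (map (\<lambda>_. 0) Us) = (0::'a)" by (induction Us) auto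
      then have "us = map (\<lambda>_. 0) Us"
        using inj_onD[OF inj, of us "map (\<lambda>_. 0) Us"] us zeros_in_listset[OF sub] by simp
      then show "set us \<subseteq> {0}" by auto
    qed
  next
    assume "\<forall>us\<in>listset Us. sum_list us = 0 \<longrightarrow> set us \<subseteq> {0}"
    then show "inj_on sum_list (listset Us)"
      by (intro inj_onI) (metis listset_minus[OF sub] right_minus_eq)
  qed
  then show ?thesis using sub by (auto simp: is_direct_sum_def bij_betw_def)
qed (auto simp: is_direct_sum_def)

lemma listset_image: "listset (map ((`) f) Us) = map f ` listset Us"
proof (induction Us)
  case (Cons U Us)
  have set_Cons: "set_Cons A B = (\<lambda>p. fst p # snd p) ` (A \<times> B)" for A :: "'c set" and B
    by (auto simp: set_Cons_def image_iff)
  have "f ` U \<times> map f ` listset Us = map_prod f (map f) ` (U \<times> listset Us)"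
    by (auto simp: image_iff)
  then show ?case by (simp add: Cons.IH set_Cons image_image)
qed simp

lemma is_direct_sum_image:
  assumes V: "is_direct_sum V Us" and lin: "linear f" and inj: "inj_on f V"
  shows "is_direct_sum (f ` V) (map ((`) f) Us)"
  unfolding is_direct_sum_iff listset_image
proof (intro conjI ballI impI)
  have sub: "\<forall>U\<in>set Us. subspace U" and Vdef: "V = sum_list ` listset Us"
    and ind: "\<And>us. us \<in> listset Us \<Longrightarrow> sum_list us = 0 \<Longrightarrow> set us \<subseteq> {0}"
    using V by (auto simp: is_direct_sum_iff)
  have sum: "sum_list (map f us) = f (sum_list us)" for us
    by (induction us) (simp_all add: linear_0[OF lin] linear_add[OF lin])
  then show "f ` V = sum_list ` map f ` listset Us"
    by (simp add: Vdef image_image)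
  show "subspace U" if "U \<in> set (map ((`) f) Us)" for U
    using that sub lin by (auto intro: linear_subspace_image)
  fix us assume "us \<in> map f ` listset Us" "sum_list us = 0"
  then obtain vs where vs: "us = map f vs" "vs \<in> listset Us" "f (sum_list vs) = 0"
    by (auto simp: sum)
  have "sum_list (map (\<lambda>_. 0) Us) = (0::'a)" by (induction Us) auto
  then have "0 \<in> V" unfolding Vdef using zeros_in_listset[OF sub] by (metis image_eqI)
  then have "sum_list vs = 0"
    using inj_onD[OF inj, of "sum_list vs" 0] vs linear_0[OF lin] by (simp add: Vdef)
  then have "set vs \<subseteq> {0}" using ind vs(2) by blast
  then show "set us \<subseteq> {0}" using vs(1) linear_0[OF lin] by auto
qed

lemma ball_listset_Cons:
  "(\<forall>us\<in>listset (U # Us). P us) \<longleftrightarrow> (\<forall>u\<in>U. \<forall>us\<in>listset Us. P (u # us))"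
  by (auto simp: set_Cons_def)

lemma sum_list_listset_Cons:
  "sum_list ` listset (U # Us) = {u + w | u w. u \<in> U \<and> w \<in> sum_list ` listset Us}"
  by (fastforce simp: set_Cons_def image_def)

lemma is_direct_sum_2:
  "is_direct_sum V [A, B] \<longleftrightarrow> subspace A \<and> subspace B \<and> V = {a + b | a b. a \<in> A \<and> b \<in> B} \<and>
     (\<forall>a\<in>A. \<forall>b\<in>B. a + b = 0 \<longrightarrow> a = 0 \<and> b = 0)"
  unfolding is_direct_sum_iff ball_listset_Cons sum_list_listset_Cons by simp

lemma is_direct_sum_3:
  "is_direct_sum V [A, B, C] \<longleftrightarrow> subspace A \<and> subspace B \<and> subspace C \<and>
     V = {a + w | a w. a \<in> A \<and> w \<in> {b + c | b c. b \<in> B \<and> c \<in> C}} \<and>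
     (\<forall>a\<in>A. \<forall>b\<in>B. \<forall>c\<in>C. a + (b + c) = 0 \<longrightarrow> a = 0 \<and> b = 0 \<and> c = 0)"
  unfolding is_direct_sum_iff ball_listset_Cons sum_list_listset_Cons by simp

lemma is_direct_sum_4:
  "is_direct_sum V [A, B, C, D] \<longleftrightarrow> subspace A \<and> subspace B \<and> subspace C \<and> subspace D \<and>
     V = {a + w | a w. a \<in> A \<and> w \<in> {b + w | b w. b \<in> B \<and> w \<in> {c + d | c d. c \<in> C \<and> d \<in> D}}} \<and>
     (\<forall>a\<in>A. \<forall>b\<in>B. \<forall>c\<in>C. \<forall>d\<in>D. a + (b + (c + d)) = 0 \<longrightarrow> a = 0 \<and> b = 0 \<and> c = 0 \<and> d = 0)"
  unfolding is_direct_sum_iff ball_listset_Cons sum_list_listset_Cons by simp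

text \<open>Splitting one summand keeps the sum direct. The parts need not stay adjacent; the order here
  is the one in which the four-term decomposition lists its summands.\<close>
lemma is_direct_sum_refine:
  assumes V: "is_direct_sum V [W, C]" and W: "is_direct_sum W [A, B, D]"
  shows "is_direct_sum V [A, B, C, D]"
  unfolding is_direct_sum_4
proof (intro conjI ballI impI)
  have sub: "subspace A" "subspace B" "subspace C" "subspace D"
    and Vdef: "V = {w + c | w c. w \<in> W \<and> c \<in> C}"
    and Wdef: "W = {a + w | a w. a \<in> A \<and> w \<in> {b + d | b d. b \<in> B \<and> d \<in> D}}"
    and Vind: "\<forall>w\<in>W. \<forall>c\<in>C. w + c = 0 \<longrightarrow> w = 0 \<and> c = 0"
    and Wind: "\<forall>a\<in>A. \<forall>b\<in>B. \<forall>d\<in>D. a + (b + d) = 0 \<longrightarrow> a = 0 \<and> b = 0 \<and> d = 0"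
    using V W unfolding is_direct_sum_2 is_direct_sum_3 by simp_all
  show "subspace A" "subspace B" "subspace C" "subspace D" by fact+
  have eq: "a + (b + (c + d)) = (a + (b + d)) + c" for a b c d :: 'a
    by (simp add: algebra_simps)
  have WI: "a + (b + d) \<in> W" if "a \<in> A" "b \<in> B" "d \<in> D" for a b d
    using that unfolding Wdef by blast
  show "V = {a + w | a w. a \<in> A \<and> w \<in> {b + w | b w. b \<in> B \<and> w \<in> {c + d | c d. c \<in> C \<and> d \<in> D}}}"
    (is "_ = ?R")
  proof (intro equalityI subsetI)
    fix v assume "v \<in> V"
    then obtain a b d c where *: "v = (a + (b + d)) + c" "a \<in> A" "b \<in> B" "c \<in> C" "d \<in> D"
      unfolding Vdef Wdef by blast
    show "v \<in> ?R" unfolding *(1) eq[symmetric] using *(2-) by blast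
  next
    fix v assume "v \<in> ?R"
    then obtain a b d c where *: "v = a + (b + (c + d))" "a \<in> A" "b \<in> B" "c \<in> C" "d \<in> D"
      by blast
    show "v \<in> V" unfolding *(1) eq Vdef using WI[OF *(2,3,5)] *(4) by blast
  qed
  fix a b c d assume *: "a \<in> A" "b \<in> B" "c \<in> C" "d \<in> D" "a + (b + (c + d)) = 0"
  have "a + (b + d) = 0 \<and> c = 0" using Vind WI[OF *(1,2,4)] *(3,5) eq by metis
  then show "a = 0" "b = 0" "c = 0" "d = 0" using Wind * by blast+
qed

text \<open>A linear injection maps the standard basis to a basis of its range, so counting parameters
  determines dimensions inside the infinite-dimensional space of all functions.\<close>
lemma dim_range_linear:
  fixes f :: "'a::euclidean_space \<Rightarrow> 'b::real_vector"
  assumes "linear f" "inj f"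
  shows "dim (range f) = DIM('a)"
proof -
  have "independent (f ` Basis)"
    using assms by (simp add: linear_independent_injective_image independent_Basis)
  moreover have "span (f ` Basis) = range f"
    using assms by (simp add: linear_span_image span_Basis)
  ultimately have "dim (range f) = card (f ` Basis)"
    by (metis dim_span dim_eq_card_independent)
  then show ?thesis using assms by (simp add: card_image inj_on_subset)
qed

section \<open>Polynomials and their restrictions to a set\<close>

lemma linear_on: "linear (on S)"
  by (rule linearI) (auto simp: on_def scaleR_fun_def)

lemma on_UNIV [simp]: "on UNIV f = f"
  by (simp add: on_def)

lemma image_Collect_2: "f ` {g i j | i j. P i j} = {f (g i j) | i j. P i j}"
  by auto

lemma Pol_UNIV: "Pol p UNIV = span {\<lambda>x. x$1 ^ i * x$2 ^ j | i j. i + j \<le> p}"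
  by (simp add: Pol_def)

lemma Pol_hom_UNIV: "Pol_hom p UNIV = span {\<lambda>x. x$1 ^ i * x$2 ^ j | i j. i + j = p}"
  by (simp add: Pol_hom_def)

lemma Pol_eq_on: "Pol p S = on S ` Pol p UNIV"
  unfolding Pol_UNIV Pol_def linear_span_image[OF linear_on, symmetric]
    image_Collect_2 on_UNIV ..

lemma Pol_hom_eq_on: "Pol_hom p S = on S ` Pol_hom p UNIV"
  unfolding Pol_hom_UNIV Pol_hom_def linear_span_image[OF linear_on, symmetric]
    image_Collect_2 on_UNIV ..

lemma subspace_Pol: "subspace (Pol p S)"
  by (simp add: Pol_def)

lemma Pol_add: "f \<in> Pol p UNIV \<Longrightarrow> g \<in> Pol p UNIV \<Longrightarrow> (\<lambda>x. f x + g x) \<in> Pol p UNIV"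
  using subspace_add[OF subspace_Pol] by (simp add: plus_fun_def)

lemma Pol_scale: "f \<in> Pol p UNIV \<Longrightarrow> (\<lambda>x. c * f x) \<in> Pol p UNIV"
  using subspace_scale[OF subspace_Pol, of f p UNIV c] by (simp add: scaleR_fun_def)

lemma Pol_monomial: "i + j \<le> p \<Longrightarrow> (\<lambda>x. x$1 ^ i * x$2 ^ j) \<in> Pol p UNIV"
  unfolding Pol_UNIV by (intro span_base CollectI exI[of _ i] exI[of _ j]) simp

lemma Pol_const: "(\<lambda>x. c) \<in> Pol p UNIV"
  using Pol_scale[OF Pol_monomial[of 0 0 p], of c] by simp

lemma Pol_sum: "(\<And>i. i \<in> A \<Longrightarrow> f i \<in> Pol p UNIV) \<Longrightarrow> (\<lambda>x. \<Sum>i\<in>A. f i x) \<in> Pol p UNIV"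
  using Pol_const[of 0] by (induction A rule: infinite_finite_induct) (auto intro: Pol_add)

lemma Pol_coord: "(\<lambda>x. x $ i) \<in> Pol (Suc p) UNIV"
  using Pol_monomial[of 1 0 "Suc p"] Pol_monomial[of 0 1 "Suc p"] exhaust_2[of i] by auto

lemma Pol_mult:
  assumes "f \<in> Pol p UNIV" "g \<in> Pol q UNIV"
  shows "(\<lambda>x. f x * g x) \<in> Pol (p + q) UNIV"
proof -
  have *: "(\<lambda>x. x$1 ^ i * x$2 ^ j * g x) \<in> Pol (p + q) UNIV" if "i + j \<le> p" for i j
    using assms(2) unfolding Pol_UNIV[of q]
  proof (induction rule: span_induct_alt)
    case base
    then show ?case using Pol_const[of 0] by simp
  next
    case (step c m g)
    then obtain k l where m: "m = (\<lambda>x. x$1 ^ k * x$2 ^ l)" "k + l \<le> q" by auto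
    have "(\<lambda>x. c * (x$1 ^ (i + k) * x$2 ^ (j + l)) + x$1 ^ i * x$2 ^ j * g x) \<in> Pol (p + q) UNIV"
      using that m(2) by (intro Pol_add Pol_scale Pol_monomial step.IH) auto
    then show ?case by (simp add: m scaleR_fun_def power_add algebra_simps)
  qed
  show ?thesis using assms(1) unfolding Pol_UNIV[of p]
  proof (induction rule: span_induct_alt)
    case base
    then show ?case using Pol_const[of 0] by simp
  next
    case (step c m f)
    then obtain k l where m: "m = (\<lambda>x. x$1 ^ k * x$2 ^ l)" "k + l \<le> p" by auto
    have "(\<lambda>x. c * (x$1 ^ k * x$2 ^ l * g x) + f x * g x) \<in> Pol (p + q) UNIV"
      using m(2) by (intro Pol_add Pol_scale * step.IH)
    then show ?case by (simp add: m scaleR_fun_def algebra_simps)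
  qed
qed

lemma Pol_linear: "(\<lambda>x. h \<bullet> x) \<in> Pol (Suc p) UNIV"
  unfolding inner_vec_def inner_real_def
  by (intro Pol_sum Pol_scale Pol_coord)

lemma Pol_has_derivative:
  assumes "f \<in> Pol (Suc p) UNIV"
  shows "\<exists>g\<in>Pol p UNIV. \<forall>x. ((\<lambda>s. f (x + s *\<^sub>R v)) has_real_derivative g x) (at 0)"
  using assms unfolding Pol_UNIV[of "Suc p"]
proof (induction rule: span_induct_alt)
  case base
  then show ?case using Pol_const[of 0 p] by force
next
  case (step c m f)
  then obtain g where g: "g \<in> Pol p UNIV"
    "\<And>x. ((\<lambda>s. f (x + s *\<^sub>R v)) has_real_derivative g x) (at 0)" by blast
  obtain i j where m: "m = (\<lambda>x. x$1 ^ i * x$2 ^ j)" "i + j \<le> Suc p" using step by auto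
  (* If i = 0, the factor i makes the first summand zero, whatever the truncated exponent i - 1 is. *)
  let ?d = "\<lambda>x. v$1 * i * (x$1 ^ (i - 1) * x$2 ^ j) + v$2 * j * (x$1 ^ i * x$2 ^ (j - 1))"
  have "(\<lambda>x. v$1 * i * (x$1 ^ (i - 1) * x$2 ^ j)) \<in> Pol p UNIV"
    using m(2) by (cases i) (auto intro!: Pol_scale Pol_monomial Pol_const[of 0, simplified])
  moreover have "(\<lambda>x. v$2 * j * (x$1 ^ i * x$2 ^ (j - 1))) \<in> Pol p UNIV"
    using m(2) by (cases j) (auto intro!: Pol_scale Pol_monomial Pol_const[of 0, simplified])
  ultimately have "(\<lambda>x. c * ?d x + g x) \<in> Pol p UNIV"
    using g(1) by (intro Pol_add Pol_scale[of ?d]) auto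
  moreover have "((\<lambda>s. (c *\<^sub>R m + f) (x + s *\<^sub>R v)) has_real_derivative c * ?d x + g x) (at 0)" for x
    unfolding m by (auto intro!: derivative_eq_intros g(2) simp: scaleR_fun_def algebra_simps)
  ultimately show ?case by (intro bexI[of _ "\<lambda>x. c * ?d x + g x"] allI)
qed

lemma Pol_dir_deriv:
  assumes "f \<in> Pol (Suc p) UNIV"
  shows "dir_deriv v f \<in> Pol p UNIV"
    "((\<lambda>s. f (x + s *\<^sub>R v)) has_real_derivative dir_deriv v f x) (at 0)"
proof -
  obtain g where g: "g \<in> Pol p UNIV"
    "\<And>x. ((\<lambda>s. f (x + s *\<^sub>R v)) has_real_derivative g x) (at 0)"
    using Pol_has_derivative[OF assms] by blast
  moreover have "dir_deriv v f = g"
    unfolding dir_deriv_def using g(2) by (auto intro!: DERIV_imp_deriv)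
  ultimately show "dir_deriv v f \<in> Pol p UNIV"
    "((\<lambda>s. f (x + s *\<^sub>R v)) has_real_derivative dir_deriv v f x) (at 0)" by auto
qed

lemma Pol_real_polynomial_function: "f \<in> Pol p UNIV \<Longrightarrow> real_polynomial_function f"
  unfolding Pol_UNIV
proof (induction rule: span_induct_alt)
  case base
  then show ?case by (simp add: zero_fun_def real_polynomial_function.intros)
next
  case (step c m f)
  have "real_polynomial_function (\<lambda>x::real^2. x $ i)" for i
    by (rule real_polynomial_function.intros(1)) (rule bounded_linear_vec_nth)
  then have "real_polynomial_function m"
    using step(1) by (auto intro!: real_polynomial_function.intros(4) real_polynomial_function_power)
  then have "real_polynomial_function (\<lambda>x. c * m x + f x)"
    using step by (intro real_polynomial_function.intros(2-4))
  then show ?case by (simp add: scaleR_fun_def plus_fun_def)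
qed

lemma Pol_continuous: "f \<in> Pol p UNIV \<Longrightarrow> isCont f x"
  by (rule continuous_real_polymonial_function) (rule Pol_real_polynomial_function)

text \<open>Along every line through a point of \<open>S\<close>, \<open>f\<close> is a univariate polynomial with infinitely many
  zeros.\<close>
lemma Pol_eq_0_if_eq_0_on_open:
  assumes f: "f \<in> Pol p UNIV" and S: "open S" "S \<noteq> {}" and zero: "\<And>x. x \<in> S \<Longrightarrow> f x = 0"
  shows "f = 0"
proof
  fix x
  obtain y where "y \<in> S" using S by blast
  define l where "l t = y + t *\<^sub>R (x - y)" for t :: real
  have "polynomial_function l"
    unfolding l_def
    by (intro polynomial_function_add polynomial_function_const polynomial_function_mult
        polynomial_function_id[unfolded id_def])
  then have "real_polynomial_function (f \<circ> l)"
    using Pol_real_polynomial_function[OF f] by (simp add: real_polynomial_function_compose)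
  then obtain a n where a: "f (l t) = (\<Sum>i\<le>n. a i * t ^ i)" for t
    unfolding real_polynomial_function_iff_sum by (metis comp_apply)
  have "open (l -` S)"
    using S(1) unfolding l_def by (intro open_vimage continuous_intros) auto
  moreover have "0 \<in> l -` S" using \<open>y \<in> S\<close> by (simp add: l_def)
  ultimately have "infinite (l -` S)"
    using finite_imp_not_open by blast
  moreover have "l -` S \<subseteq> {t. (\<Sum>i\<le>n. a i * t ^ i) = 0}"
    using zero by (auto simp flip: a)
  ultimately have "infinite {t. (\<Sum>i\<le>n. a i * t ^ i) = 0}"
    using finite_subset by blast
  then have "\<forall>k\<le>n. a k = 0" unfolding polyfun_finite_roots by blast
  then have "(\<Sum>i\<le>n. a i * t ^ i) = 0" for t by simp
  then have "f (l 1) = 0" by (simp only: a)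
  then show "f x = 0 x" by (simp add: l_def)
qed

section \<open>Polynomials of low degree and Raviart--Thomas fields in coordinates\<close>

lemma Pol_0_eq: "Pol 0 UNIV = range (\<lambda>c x. c)"
proof -
  have "{\<lambda>x::real^2. x$1 ^ i * x$2 ^ j | i j. i + j \<le> 0} = {\<lambda>x. 1}" by auto
  then show ?thesis by (auto simp: Pol_UNIV span_singleton scaleR_fun_def)
qed

definition aff :: "real^3 \<Rightarrow> real^2 \<Rightarrow> real" where
  "aff c x = c$1 + c$2 * x$1 + c$3 * x$2"

definition quadr :: "real^3 \<Rightarrow> real^2 \<Rightarrow> real" where
  "quadr c x = c$1 * x$1^2 + c$2 * (x$1 * x$2) + c$3 * x$2^2"

lemma linear_aff: "linear aff"
  by (rule linearI) (simp_all add: aff_def fun_eq_iff scaleR_fun_def algebra_simps)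

lemma linear_quadr: "linear quadr"
  by (rule linearI) (simp_all add: quadr_def fun_eq_iff scaleR_fun_def algebra_simps)

lemma Pol_1_eq: "Pol 1 UNIV = range aff"
proof
  show "Pol 1 UNIV \<subseteq> range aff"
    unfolding Pol_UNIV
  proof (rule span_minimal)
    show "subspace (range aff)" by (rule linear_subspace_image[OF linear_aff subspace_UNIV])
    show "{\<lambda>x. x$1 ^ i * x$2 ^ j | i j. i + j \<le> 1} \<subseteq> range aff"
    proof clarify
      fix i j :: nat assume "i + j \<le> 1"
      then consider "i = 0" "j = 0" | "i = 1" "j = 0" | "i = 0" "j = 1" by linarith
      then show "(\<lambda>x. x$1 ^ i * x$2 ^ j) \<in> range aff"
      proof cases
        case 1
        show ?thesis by (rule range_eqI[of _ _ "vector [1, 0, 0]"]) (simp add: 1 aff_def fun_eq_iff)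
      next
        case 2
        show ?thesis by (rule range_eqI[of _ _ "vector [0, 1, 0]"]) (simp add: 2 aff_def fun_eq_iff)
      next
        case 3
        show ?thesis by (rule range_eqI[of _ _ "vector [0, 0, 1]"]) (simp add: 3 aff_def fun_eq_iff)
      qed
    qed
  qed
  have "aff c \<in> Pol 1 UNIV" for c
    unfolding aff_def using Pol_coord[of _ 0] by (auto intro!: Pol_add Pol_scale Pol_const)
  then show "range aff \<subseteq> Pol 1 UNIV" by blast
qed

lemma Pol_hom_1_eq: "Pol_hom 1 UNIV = range (\<bullet>)"
proof
  show "Pol_hom 1 UNIV \<subseteq> range (\<bullet>)"
    unfolding Pol_hom_UNIV
  proof (rule span_minimal)
    have "linear (\<lambda>h x. h \<bullet> x :: real)"
      by (rule linearI) (auto simp: fun_eq_iff scaleR_fun_def inner_add_left)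
    then show "subspace (range ((\<bullet>) :: real^2 \<Rightarrow> _))" by (rule linear_subspace_image[OF _ subspace_UNIV])
    show "{\<lambda>x::real^2. x$1 ^ i * x$2 ^ j | i j. i + j = 1} \<subseteq> range (\<bullet>)"
    proof clarify
      fix i j :: nat assume "i + j = 1"
      then consider "i = 1" "j = 0" | "i = 0" "j = 1" by linarith
      then show "(\<lambda>x::real^2. x$1 ^ i * x$2 ^ j) \<in> range (\<bullet>)"
      proof cases
        case 1
        show ?thesis
          by (rule range_eqI[of _ _ "vector [1, 0] :: real^2"]) (simp add: 1 inner_vec_def sum_2 fun_eq_iff)
      next
        case 2
        show ?thesis
          by (rule range_eqI[of _ _ "vector [0, 1] :: real^2"]) (simp add: 2 inner_vec_def sum_2 fun_eq_iff)
      qed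
    qed
  qed
  have "(\<bullet>) h \<in> Pol_hom 1 UNIV" for h :: "real^2"
  proof -
    have "(\<lambda>x::real^2. x$1 ^ i * x$2 ^ j) \<in> Pol_hom 1 UNIV" if "i + j = 1" for i j
      unfolding Pol_hom_UNIV by (intro span_base CollectI exI[of _ i] exI[of _ j]) (simp add: that)
    from this[of 1 0] this[of 0 1]
    have "h$1 *\<^sub>R (\<lambda>x. x$1) + h$2 *\<^sub>R (\<lambda>x. x$2) \<in> Pol_hom 1 UNIV"
      unfolding Pol_hom_def by (auto intro!: span_add span_scale)
    moreover have "(\<bullet>) h = h$1 *\<^sub>R (\<lambda>x. x$1) + h$2 *\<^sub>R (\<lambda>x. x$2)"
      by (simp add: inner_vec_def sum_2 scaleR_fun_def fun_eq_iff)
    ultimately show ?thesis by (simp only:)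
  qed
  then show "range (\<bullet>) \<subseteq> Pol_hom 1 UNIV" by blast
qed

lemma Pol_hom_2_eq: "Pol_hom 2 UNIV = range quadr"
proof
  show "Pol_hom 2 UNIV \<subseteq> range quadr"
    unfolding Pol_hom_UNIV
  proof (rule span_minimal)
    show "subspace (range quadr)" by (rule linear_subspace_image[OF linear_quadr subspace_UNIV])
    show "{\<lambda>x. x$1 ^ i * x$2 ^ j | i j. i + j = 2} \<subseteq> range quadr"
    proof clarify
      fix i j :: nat assume "i + j = 2"
      then consider "i = 2" "j = 0" | "i = 1" "j = 1" | "i = 0" "j = 2" by linarith
      then show "(\<lambda>x. x$1 ^ i * x$2 ^ j) \<in> range quadr"
      proof cases
        case 1
        show ?thesis by (rule range_eqI[of _ _ "vector [1, 0, 0]"]) (simp add: 1 quadr_def fun_eq_iff)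
      next
        case 2
        show ?thesis by (rule range_eqI[of _ _ "vector [0, 1, 0]"]) (simp add: 2 quadr_def fun_eq_iff)
      next
        case 3
        show ?thesis by (rule range_eqI[of _ _ "vector [0, 0, 1]"]) (simp add: 3 quadr_def fun_eq_iff)
      qed
    qed
  qed
  have "quadr c \<in> Pol_hom 2 UNIV" for c
  proof -
    have "(\<lambda>x::real^2. x$1 ^ i * x$2 ^ j) \<in> Pol_hom 2 UNIV" if "i + j = 2" for i j
      unfolding Pol_hom_UNIV by (intro span_base CollectI exI[of _ i] exI[of _ j]) (simp add: that)
    from this[of 2 0] this[of 1 1] this[of 0 2]
    have "c$1 *\<^sub>R (\<lambda>x. x$1^2) + c$2 *\<^sub>R (\<lambda>x. x$1 * x$2) + c$3 *\<^sub>R (\<lambda>x. x$2^2) \<in> Pol_hom 2 UNIV"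
      unfolding Pol_hom_def by (auto intro!: span_add span_scale)
    then show ?thesis by (simp add: quadr_def[abs_def] scaleR_fun_def plus_fun_def)
  qed
  then show "range quadr \<subseteq> Pol_hom 2 UNIV" by blast
qed

lemma RT_0_eq: "RT 0 UNIV = {\<lambda>x. c + a *\<^sub>R x | c a. True}"
proof (intro equalityI subsetI)
  have hom: "Pol_hom 0 UNIV = Pol 0 UNIV" by (simp add: Pol_def Pol_hom_def)
  fix \<phi> assume "\<phi> \<in> RT 0 UNIV"
  then obtain f \<eta> where *: "\<phi> = f + (\<lambda>x. \<eta> x *\<^sub>R x)" "\<And>i. (\<lambda>x. f x $ i) \<in> Pol 0 UNIV" "\<eta> \<in> Pol_hom 0 UNIV"
    by (auto simp: RT_def Pol_vec_def)
  obtain a where "\<eta> = (\<lambda>x. a)" using *(3) by (auto simp: hom Pol_0_eq)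
  moreover have "f x = f 0" for x
    using *(2) unfolding Pol_0_eq image_iff by (metis vec_eq_iff)
  ultimately have "\<phi> = (\<lambda>x. f 0 + a *\<^sub>R x)" by (auto simp: *(1))
  then show "\<phi> \<in> {\<lambda>x. c + a *\<^sub>R x | c a. True}" by blast
next
  have hom: "Pol_hom 0 UNIV = Pol 0 UNIV" by (simp add: Pol_def Pol_hom_def)
  fix \<phi> assume "\<phi> \<in> {\<lambda>x::real^2. c + a *\<^sub>R x | c a. True}"
  then obtain c a where "\<phi> = (\<lambda>x. c + a *\<^sub>R x)" by auto
  then have "\<phi> = (\<lambda>x. c) + (\<lambda>x. a *\<^sub>R x)" by (simp add: plus_fun_def)
  moreover have "(\<lambda>x. c) \<in> Pol_vec 0 UNIV" by (simp add: Pol_vec_def Pol_const)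
  moreover have "(\<lambda>x. a) \<in> Pol_hom 0 UNIV" by (simp add: hom Pol_const)
  ultimately show "\<phi> \<in> RT 0 UNIV"
    unfolding RT_def by (intro CollectI exI[of _ "\<lambda>x. c"] exI[of _ "\<lambda>x. a"]) simp
qed

lemma matrix_vector_mult_2:
  fixes A :: "real^2^2"
  shows "(A *v x) $ i = A $ i $ 1 * x $ 1 + A $ i $ 2 * x $ 2"
  by (simp add: matrix_vector_mult_def sum_2)

lemma Pol_vec_1_eq: "Pol_vec 1 UNIV = {\<lambda>x. c + C *v x | c C. True}"
proof (intro equalityI subsetI)
  fix f assume "f \<in> Pol_vec 1 UNIV"
  then obtain k where "\<And>i. (\<lambda>x. f x $ i) = aff (k i)"
    unfolding Pol_vec_def Pol_1_eq image_iff by simp metis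
  then have k: "f x $ i = aff (k i) x" for x i by metis
  have "f = (\<lambda>x. (\<chi> i. k i $ 1) + (\<chi> i j. if j = 1 then k i $ 2 else k i $ 3) *v x)"
    by (simp add: fun_eq_iff vec_eq_iff k aff_def matrix_vector_mult_2)
  then show "f \<in> {\<lambda>x. c + C *v x | c C. True}" by blast
next
  fix f assume "f \<in> {\<lambda>x::real^2. c + (C::real^2^2) *v x | c C. True}"
  then obtain c C where "f = (\<lambda>x. c + C *v x)" by auto
  then show "f \<in> Pol_vec 1 UNIV"
    using Pol_coord[of _ 0]
    by (auto simp: Pol_vec_def matrix_vector_mult_2 intro!: Pol_add Pol_const Pol_scale)
qed

lemma RT_1_eq: "RT 1 UNIV = {\<lambda>x. c + C *v x + (h \<bullet> x) *\<^sub>R x | c C h. True}"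
proof (intro equalityI subsetI)
  fix \<phi> assume "\<phi> \<in> RT 1 UNIV"
  then obtain c C h where "\<phi> = (\<lambda>x. c + C *v x) + (\<lambda>x. (h \<bullet> x) *\<^sub>R x)"
    unfolding RT_def Pol_vec_1_eq Pol_hom_1_eq by blast
  then show "\<phi> \<in> {\<lambda>x. c + C *v x + (h \<bullet> x) *\<^sub>R x | c C h. True}"
    by (auto simp: plus_fun_def)
next
  fix \<phi> assume "\<phi> \<in> {\<lambda>x::real^2. c + (C::real^2^2) *v x + (h \<bullet> x) *\<^sub>R x | c C h. True}"
  then obtain c h and C :: "real^2^2" where "\<phi> = (\<lambda>x. c + C *v x + (h \<bullet> x) *\<^sub>R x)" by auto
  then have "\<phi> = (\<lambda>x. c + C *v x) + (\<lambda>x. (h \<bullet> x) *\<^sub>R x)"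
    by (simp add: plus_fun_def)
  then show "\<phi> \<in> RT 1 UNIV"
    unfolding RT_def Pol_vec_1_eq Pol_hom_1_eq
    by (intro CollectI exI[of _ "\<lambda>x. c + C *v x"] exI[of _ "(\<bullet>) h"]) auto
qed

section \<open>Symmetrised tensor products\<close>

lemma linear_sym_part: "linear sym_part"
  by (rule linearI) (simp_all add: sym_part_def transpose_def vec_eq_iff algebra_simps)

lemma linear_sym_part_comp: "linear (\<lambda>M. sym_part \<circ> M)"
  by (rule linearI)
    (simp_all add: fun_eq_iff scaleR_fun_def linear_add[OF linear_sym_part] linear_scale[OF linear_sym_part])

lemma sym_tensor_eq_span:
  "sym_space (tensor_space X Y) = span {\<lambda>x. sym_part (outer (\<phi> x) (\<psi> x)) | \<phi> \<psi>. \<phi> \<in> X \<and> \<psi> \<in> Y}"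
  unfolding sym_space_def tensor_space_def linear_span_image[OF linear_sym_part_comp, symmetric]
    image_Collect_2 comp_def ..

lemma subspace_sym_tensor: "subspace (sym_space (tensor_space X Y))"
  by (simp add: sym_tensor_eq_span)

lemma sym_tensorI:
  assumes "\<phi> \<in> X" "\<psi> \<in> Y"
  shows "(\<lambda>x. sym_part (outer (\<phi> x) (\<psi> x))) \<in> sym_space (tensor_space X Y)"
  unfolding sym_tensor_eq_span
  using assms by (intro span_base CollectI exI[of _ \<phi>] exI[of _ \<psi>]) auto

lemma outer_nth [simp]: "outer u v $ i $ j = u$i * v$j"
  by (simp add: outer_def)

lemma sym_part_outer: "sym_part (outer u v) $ i $ j = (u$i * v$j + u$j * v$i) / 2"
  by (simp add: sym_part_def outer_def transpose_def)

definition symmat :: "real \<Rightarrow> real \<Rightarrow> real \<Rightarrow> real^2^2" where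
  "symmat a b d = vector [vector [a, b], vector [b, d]]"

lemma symmat_nth [simp]: "symmat a b d $ 1 $ 1 = a" "symmat a b d $ 1 $ 2 = b"
  "symmat a b d $ 2 $ 1 = b" "symmat a b d $ 2 $ 2 = d"
  by (simp_all add: symmat_def)

text \<open>The rows of the parameter are the coefficients of the entries at the positions \<open>(1,1)\<close>, \<open>(1,2)\<close>
  and \<open>(2,2)\<close>.\<close>
definition P1_sym_field :: "real^3^3 \<Rightarrow> real^2 \<Rightarrow> real^2^2" where
  "P1_sym_field A x = symmat (aff (A$1) x) (aff (A$2) x) (aff (A$3) x)"

text \<open>This is the symmetric curl of the vector field \<open>\<lambda>x. quadr b x *\<^sub>R x\<close>, evaluated.\<close>
definition P2_field :: "real^3 \<Rightarrow> real^2 \<Rightarrow> real^2^2" where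
  "P2_field b x = symmat (b$2 * x$1^2 + 2 * b$3 * x$1 * x$2) (b$3 * x$2^2 - b$1 * x$1^2)
     (- 2 * b$1 * x$1 * x$2 - b$2 * x$2^2)"

text \<open>The parameters \<open>p\<close> and \<open>t\<close> are the coefficients of the three quadratic and the two cubic
  generators of \<open>P3_tilde_ref\<close>.\<close>
definition P3_field :: "(real^3) \<times> (real^2) \<Rightarrow> real^2 \<Rightarrow> real^2^2" where
  "P3_field = (\<lambda>(p, t) x. symmat
     (p$1 * x$1^2 + 2 * t$1 * x$1^3 + 4 * t$2 * x$1^2 * x$2)
     (p$1 * x$1 * x$2 + p$2 * x$2^2 - t$1 * x$1^2 * x$2 + t$2 * x$1 * x$2^2)
     (- 2 * p$1 * x$2^2 + p$3 * x$1 * x$2 - 4 * t$1 * x$1 * x$2^2 - 2 * t$2 * x$2^3))"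

definition xxT_field :: "real^3 \<Rightarrow> real^2 \<Rightarrow> real^2^2" where
  "xxT_field d x = aff d x *\<^sub>R outer x x"

lemmas field_defs = P1_sym_field_def P2_field_def P3_field_def xxT_field_def aff_def

lemma linear_P1_sym_field: "linear P1_sym_field"
  by (rule linearI) (simp_all add: field_defs fun_eq_iff vec_eq_iff forall_2 scaleR_fun_def algebra_simps)

lemma linear_P2_field: "linear P2_field"
  by (rule linearI) (simp_all add: field_defs fun_eq_iff vec_eq_iff forall_2 scaleR_fun_def algebra_simps)

lemma linear_P3_field: "linear P3_field"
  by (rule linearI) (auto simp add: field_defs fun_eq_iff vec_eq_iff forall_2 scaleR_fun_def algebra_simps)

lemma linear_xxT_field: "linear xxT_field"
  by (rule linearI) (simp_all add: field_defs fun_eq_iff vec_eq_iff forall_2 scaleR_fun_def algebra_simps)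

text \<open>The ten points used are unisolvent for cubic polynomials: evaluation there gives an
  invertible linear system for the coefficients.\<close>
lemma cubic_eq_0:
  assumes "\<And>x y. c00 + c10 * x + c01 * y + c20 * x^2 + c11 * (x * y) + c02 * y^2
    + c30 * x^3 + c21 * (x^2 * y) + c12 * (x * y^2) + c03 * y^3 = (0::real)"
  shows "c00 = 0 \<and> c10 = 0 \<and> c01 = 0 \<and> c20 = 0 \<and> c11 = 0 \<and> c02 = 0
    \<and> c30 = 0 \<and> c21 = 0 \<and> c12 = 0 \<and> c03 = 0"
  using assms[of 0 0] assms[of 1 0] assms[of "-1" 0] assms[of 2 0] assms[of 0 1] assms[of 0 "-1"]
    assms[of 0 2] assms[of 1 1] assms[of "-1" 1] assms[of 1 "-1"]
  by simp

text \<open>The coefficients couple only in small groups. For instance \<open>x^2\<close> at \<open>(1,1)\<close>, \<open>x y\<close> at \<open>(1,2)\<close> and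
  \<open>y^2\<close> at \<open>(2,2)\<close> give \<open>b\<^sub>2 + p\<^sub>1 + d\<^sub>1 = p\<^sub>1 + d\<^sub>1 = d\<^sub>1 - b\<^sub>2 - 2 p\<^sub>1 = 0\<close>, which forces all three
  parameters to vanish.\<close>
lemma fields_independent:
  assumes "P1_sym_field A + (P2_field b + (P3_field (p, t) + xxT_field d)) = 0"
  shows "A = 0 \<and> b = 0 \<and> p = 0 \<and> t = 0 \<and> d = 0"
proof -
  have 0: "(P1_sym_field A x + (P2_field b x + (P3_field (p, t) x + xxT_field d x))) $ i $ j = 0" for x i j
    using assms by (simp add: fun_eq_iff)
  have 11: "A$1$1 + A$1$2 * x + A$1$3 * y + (b$2 + p$1 + d$1) * x^2 + 2 * b$3 * (x * y) + 0 * y^2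
    + (2 * t$1 + d$2) * x^3 + (4 * t$2 + d$3) * (x^2 * y) + 0 * (x * y^2) + 0 * y^3 = 0" for x y
    using 0[of "vector [x, y]" 1 1] by (simp add: field_defs power2_eq_square power3_eq_cube algebra_simps)
  have 12: "A$2$1 + A$2$2 * x + A$2$3 * y + (- b$1) * x^2 + (p$1 + d$1) * (x * y) + (b$3 + p$2) * y^2
    + 0 * x^3 + (d$2 - t$1) * (x^2 * y) + (t$2 + d$3) * (x * y^2) + 0 * y^3 = 0" for x y
    using 0[of "vector [x, y]" 1 2] by (simp add: field_defs power2_eq_square power3_eq_cube algebra_simps)
  have 22: "A$3$1 + A$3$2 * x + A$3$3 * y + 0 * x^2 + (p$3 - 2 * b$1) * (x * y)
    + (d$1 - b$2 - 2 * p$1) * y^2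
    + 0 * x^3 + 0 * (x^2 * y) + (d$2 - 4 * t$1) * (x * y^2) + (d$3 - 2 * t$2) * y^3 = 0" for x y
    using 0[of "vector [x, y]" 2 2] by (simp add: field_defs power2_eq_square power3_eq_cube algebra_simps)
  show ?thesis
    using cubic_eq_0[OF 11] cubic_eq_0[OF 12] cubic_eq_0[OF 22]
    by (simp add: vec_eq_iff forall_2 forall_3)
qed

abbreviation (input) X_triangle_global where
  "X_triangle_global \<equiv> sym_space (tensor_space (RT 0 UNIV) (RT 1 UNIV))"

lemma RT_0I: "(\<lambda>x. c + a *\<^sub>R x) \<in> RT 0 UNIV"
  unfolding RT_0_eq by blast

lemma RT_1I: "(\<lambda>x. c + C *v x + (h \<bullet> x) *\<^sub>R x) \<in> RT 1 UNIV"
  unfolding RT_1_eq by blast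

lemma P1_sym_field_in_X_triangle: "P1_sym_field A \<in> X_triangle_global"
proof -
  (* The factor 2 compensates for the symmetrisation, which halves off-diagonal entries. *)
  define \<phi> :: "2 \<Rightarrow> real^2 \<Rightarrow> real^2" where "\<phi> k x = axis k 1 + 0 *\<^sub>R x" for k x
  define \<psi> where "\<psi> x = vector [A$1$1, 2 * A$2$1]
    + vector [vector [A$1$2, A$1$3], vector [2 * A$2$2, 2 * A$2$3]] *v x + (0 \<bullet> x) *\<^sub>R x" for x :: "real^2"
  define \<psi>' where "\<psi>' x = vector [0, A$3$1]
    + vector [vector [0, 0], vector [A$3$2, A$3$3]] *v x + (0 \<bullet> x) *\<^sub>R x" for x :: "real^2"
  have "(\<lambda>x. sym_part (outer (\<phi> 1 x) (\<psi> x))) + (\<lambda>x. sym_part (outer (\<phi> 2 x) (\<psi>' x))) \<in> X_triangle_global"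
    unfolding \<phi>_def \<psi>_def \<psi>'_def
    by (intro subspace_add[OF subspace_sym_tensor] sym_tensorI RT_0I RT_1I)
  moreover have "P1_sym_field A = (\<lambda>x. sym_part (outer (\<phi> 1 x) (\<psi> x))) + (\<lambda>x. sym_part (outer (\<phi> 2 x) (\<psi>' x)))"
    by (simp add: fun_eq_iff vec_eq_iff forall_2 field_defs sym_part_outer
        \<phi>_def \<psi>_def \<psi>'_def axis_def matrix_vector_mult_2)
  ultimately show ?thesis by simp
qed

text \<open>By the product rule, \<open>Curl (\<eta> x) = x (curl \<eta>)^T + \<eta> Curl x\<close>, and \<open>Curl x\<close> is skew-symmetric. So
  the symmetric curl is the symmetrised product of \<open>x\<close> with \<open>curl \<eta>\<close>, the linear field given by the
  matrix \<open>C\<close>.\<close>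
lemma P2_field_in_X_triangle: "P2_field b \<in> X_triangle_global"
proof -
  define C :: "real^2^2" where "C = vector [vector [b$2, 2 * b$3], vector [-2 * b$1, - b$2]]"
  have "P2_field b = (\<lambda>x. sym_part (outer (0 + 1 *\<^sub>R x) (0 + C *v x + (0 \<bullet> x) *\<^sub>R x)))"
    by (simp add: fun_eq_iff vec_eq_iff forall_2 P2_field_def sym_part_outer C_def
        matrix_vector_mult_2 power2_eq_square algebra_simps)
  then show ?thesis by (simp only:) (rule sym_tensorI[OF RT_0I RT_1I])
qed

lemma xxT_field_in_X_triangle: "xxT_field d \<in> X_triangle_global"
proof -
  define h :: "real^2" where "h = vector [d$2, d$3]"
  have "xxT_field d = (\<lambda>x. sym_part (outer (0 + 1 *\<^sub>R x) (0 + mat (d$1) *v x + (h \<bullet> x) *\<^sub>R x)))"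
    by (simp add: fun_eq_iff vec_eq_iff forall_2 sym_part_outer h_def inner_vec_def sum_2 mat_def
        xxT_field_def aff_def matrix_vector_mult_2 algebra_simps)
  then show ?thesis by (simp only:) (rule sym_tensorI[OF RT_0I RT_1I])
qed

text \<open>The quadratic part of the product is the symmetrised product of \<open>x\<close> with the linear field \<open>\<chi>\<close>
  with matrix \<open>((\<alpha>, \<beta>), (\<gamma>, \<delta>)) = a C + c h^T\<close>. Curls of quadratic forms are the linear fields of trace
  zero; the remaining multiple of the identity, half the trace, contributes to \<open>x x^T\<close>.\<close>
lemma sym_tensor_RT_eq:
  fixes c c' h :: "real^2" and C :: "real^2^2" and a :: real
  defines "\<alpha> \<equiv> a * C$1$1 + h$1 * c$1" and "\<beta> \<equiv> a * C$1$2 + h$2 * c$1"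
    and "\<gamma> \<equiv> a * C$2$1 + h$1 * c$2" and "\<delta> \<equiv> a * C$2$2 + h$2 * c$2"
  shows "(\<lambda>x. sym_part (outer (c + a *\<^sub>R x) (c' + C *v x + (h \<bullet> x) *\<^sub>R x))) =
    P1_sym_field (vector [
      vector [c$1 * c'$1, c$1 * C$1$1 + a * c'$1, c$1 * C$1$2],
      vector [(c$1 * c'$2 + c$2 * c'$1) / 2, (c$1 * C$2$1 + c$2 * C$1$1 + a * c'$2) / 2,
        (c$1 * C$2$2 + c$2 * C$1$2 + a * c'$1) / 2],
      vector [c$2 * c'$2, c$2 * C$2$1, c$2 * C$2$2 + a * c'$2]])
    + (P2_field (vector [- \<gamma> / 2, (\<alpha> - \<delta>) / 2, \<beta> / 2])
    + xxT_field (vector [(\<alpha> + \<delta>) / 2, a * h$1, a * h$2]))"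
  by (simp add: fun_eq_iff vec_eq_iff forall_2 field_defs sym_part_outer assms
      matrix_vector_mult_2 inner_vec_def sum_2 power2_eq_square field_simps)

lemma subspace_range: "linear f \<Longrightarrow> subspace (range f)"
  using linear_subspace_image[OF _ subspace_UNIV] .

lemma X_triangle_global_direct_sum:
  "is_direct_sum X_triangle_global [range P1_sym_field, range P2_field, range xxT_field]"
  unfolding is_direct_sum_3
proof (intro conjI ballI impI)
  show "subspace (range P1_sym_field)" "subspace (range P2_field)" "subspace (range xxT_field)"
    by (simp_all add: subspace_range linear_P1_sym_field linear_P2_field linear_xxT_field)
  let ?G = "\<lambda>(A, b, d). P1_sym_field A + (P2_field b + xxT_field d)"
  have "linear ?G"
    by (rule linearI)
      (simp_all add: split_beta linear_add[OF linear_P1_sym_field] linear_add[OF linear_P2_field]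
        linear_add[OF linear_xxT_field] linear_scale[OF linear_P1_sym_field] scaleR_add_right
        linear_scale[OF linear_P2_field] linear_scale[OF linear_xxT_field])
  then have "subspace (range ?G)" by (rule subspace_range)
  then have sub: "X_triangle_global \<subseteq> range ?G"
    unfolding sym_tensor_eq_span
  proof (rule span_minimal[rotated], intro subsetI)
    fix M assume "M \<in> {\<lambda>x. sym_part (outer (\<phi> x) (\<psi> x)) |\<phi> \<psi>. \<phi> \<in> RT 0 UNIV \<and> \<psi> \<in> RT 1 UNIV}"
    then obtain c a c' C h
      where M: "M = (\<lambda>x. sym_part (outer (c + a *\<^sub>R x) (c' + C *v x + (h \<bullet> x) *\<^sub>R x)))"
      unfolding RT_0_eq RT_1_eq by blast
    show "M \<in> range ?G" unfolding M sym_tensor_RT_eq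
      by (rule range_eqI[of _ _ "(_, _, _)"]) (simp only: prod.case)
  qed
  show "X_triangle_global = {a + w |a w. a \<in> range P1_sym_field \<and>
      w \<in> {b + c |b c. b \<in> range P2_field \<and> c \<in> range xxT_field}}" (is "_ = ?R")
  proof (intro equalityI subsetI)
    fix M assume "M \<in> X_triangle_global"
    then obtain A b d where "M = P1_sym_field A + (P2_field b + xxT_field d)"
      using sub by force
    then show "M \<in> ?R" by blast
  next
    fix M assume "M \<in> ?R"
    then obtain A b d where "M = P1_sym_field A + (P2_field b + xxT_field d)" by blast
    then show "M \<in> X_triangle_global"
      by (simp only:) (intro subspace_add[OF subspace_sym_tensor] P1_sym_field_in_X_triangle P2_field_in_X_triangle
          xxT_field_in_X_triangle)
  qed
  fix M N K assume "M \<in> range P1_sym_field" "N \<in> range P2_field" "K \<in> range xxT_field" "M + (N + K) = 0"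
  then obtain A b d where *: "M = P1_sym_field A" "N = P2_field b" "K = xxT_field d"
    "P1_sym_field A + (P2_field b + (P3_field (0, 0) + xxT_field d)) = 0"
    using linear_0[OF linear_P3_field] by (auto simp: zero_prod_def)
  show "M = 0" "N = 0" "K = 0"
    using fields_independent[OF *(4)] *(1-3)
    by (simp_all add: linear_0[OF linear_P1_sym_field] linear_0[OF linear_P2_field] linear_0[OF linear_xxT_field])
qed

section \<open>The tensor space of the reference square\<close>

definition Q0_global :: "(real^2 \<Rightarrow> real^2) set" where
  "Q0_global = {\<lambda>x. q + (\<chi> i. d$i * x$i) | q d. True}"

abbreviation (input) X_square_global where
  "X_square_global \<equiv> sym_space (tensor_space Q0_global (RT 1 UNIV))"

lemma Q0_globalI: "(\<lambda>x. q + (\<chi> i. d$i * x$i)) \<in> Q0_global"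
  unfolding Q0_global_def by blast

lemma X_triangle_global_subset: "X_triangle_global \<subseteq> X_square_global"
  unfolding sym_tensor_eq_span
proof (intro span_mono subsetI)
  fix M assume "M \<in> {\<lambda>x. sym_part (outer (\<phi> x) (\<psi> x)) |\<phi> \<psi>. \<phi> \<in> RT 0 UNIV \<and> \<psi> \<in> RT 1 UNIV}"
  then obtain c a \<psi> where M: "M = (\<lambda>x. sym_part (outer (c + a *\<^sub>R x) (\<psi> x)))" "\<psi> \<in> RT 1 UNIV"
    unfolding RT_0_eq by blast
  have "(\<lambda>x. c + a *\<^sub>R x) = (\<lambda>x. c + (\<chi> i. (\<chi> i. a)$i * x$i))"
    by (simp add: fun_eq_iff vec_eq_iff)
  then have "(\<lambda>x. c + a *\<^sub>R x) \<in> Q0_global" by (simp only: Q0_globalI)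
  with M show "M \<in> {\<lambda>x. sym_part (outer (\<phi> x) (\<psi> x)) |\<phi> \<psi>. \<phi> \<in> Q0_global \<and> \<psi> \<in> RT 1 UNIV}"
    by (intro CollectI exI[of _ "\<lambda>x. c + a *\<^sub>R x"] exI[of _ \<psi>]) simp
qed

text \<open>The generators are sums of products of \<open>(x, 0)\<close> and \<open>(0, y)\<close> with \<open>RT 1\<close> fields; collecting the
  second factors of each gives \<open>\<psi>\<close> and \<open>\<psi>'\<close>.\<close>
lemma P3_field_in_X_square: "P3_field (p, t) \<in> X_square_global"
proof -
  define \<phi> where "\<phi> d x = 0 + (\<chi> i. d$i * x$i)" for d x :: "real^2"
  define \<psi> where "\<psi> x = 0 + vector [vector [p$1, 0], vector [0, 2 * p$1]] *v x
    + (vector [2 * t$1, 4 * t$2] \<bullet> x) *\<^sub>R x" for x :: "real^2"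
  define \<psi>' where "\<psi>' x = 0 + vector [vector [0, 2 * p$2], vector [p$3, - 2 * p$1]] *v x
    + (vector [- 4 * t$1, - 2 * t$2] \<bullet> x) *\<^sub>R x" for x :: "real^2"
  have "(\<lambda>x. sym_part (outer (\<phi> (vector [1, 0]) x) (\<psi> x)))
      + (\<lambda>x. sym_part (outer (\<phi> (vector [0, 1]) x) (\<psi>' x))) \<in> X_square_global"
    unfolding \<phi>_def \<psi>_def \<psi>'_def
    by (intro subspace_add[OF subspace_sym_tensor] sym_tensorI Q0_globalI RT_1I)
  moreover have "P3_field (p, t) = (\<lambda>x. sym_part (outer (\<phi> (vector [1, 0]) x) (\<psi> x)))
      + (\<lambda>x. sym_part (outer (\<phi> (vector [0, 1]) x) (\<psi>' x)))"
    by (simp add: fun_eq_iff vec_eq_iff forall_2 field_defs sym_part_outer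
        \<phi>_def \<psi>_def \<psi>'_def matrix_vector_mult_2 inner_vec_def sum_2
        power2_eq_square power3_eq_cube field_simps)
  ultimately show ?thesis by simp
qed

text \<open>The coefficients solve the small linear systems obtained by comparing coefficients, for example
  \<open>x^2\<close> at \<open>(1,1)\<close>, \<open>x y\<close> at \<open>(1,2)\<close> and \<open>y^2\<close> at \<open>(2,2)\<close> for the diagonal of \<open>C\<close>. These systems are
  uniquely solvable because the five additional generators complement the quadratic and cubic parts
  of the triangle space.\<close>
lemma sym_tensor_Q0_eq:
  fixes c h :: "real^2" and C :: "real^2^2"
  shows "(\<lambda>x. sym_part (outer (vector [x$1, - x$2]) (c + C *v x + (h \<bullet> x) *\<^sub>R x))) =
    P1_sym_field (vector [vector [0, c$1, 0], vector [0, c$2 / 2, - c$1 / 2], vector [0, 0, - c$2]])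
    + (P2_field (vector [- C$2$1 / 2, (3 * C$1$1 - C$2$2) / 2, C$1$2 / 2])
    + xxT_field (vector [(C$1$1 - C$2$2) / 6, h$1 / 3, - h$2 / 3]))
    + P3_field (vector [2 * (C$2$2 - C$1$1) / 3, - C$1$2, - 2 * C$2$1], vector [h$1 / 3, h$2 / 3])"
  by (simp add: fun_eq_iff vec_eq_iff forall_2 field_defs sym_part_outer
      matrix_vector_mult_2 inner_vec_def sum_2 power2_eq_square power3_eq_cube field_simps)

text \<open>A diagonal matrix is a multiple of the identity plus a multiple of \<open>diag(1, -1)\<close>. The first part
  gives an \<open>RT 0\<close> field, so only the products with \<open>(x, - y)\<close> leave the triangle space.\<close>
lemma X_square_global_direct_sum: "is_direct_sum X_square_global [X_triangle_global, range P3_field]"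
  unfolding is_direct_sum_2
proof (intro conjI ballI impI)
  show "subspace X_triangle_global" by (rule subspace_sym_tensor)
  show sub3: "subspace (range P3_field)" by (rule subspace_range[OF linear_P3_field])
  show "X_square_global = {a + b |a b. a \<in> X_triangle_global \<and> b \<in> range P3_field}" (is "_ = ?R")
  proof
    have "subspace ?R"
      using subspace_sums[OF subspace_sym_tensor sub3] by simp
    then show "X_square_global \<subseteq> ?R"
      unfolding sym_tensor_eq_span[of Q0_global]
    proof (rule span_minimal[rotated], intro subsetI)
      fix M assume "M \<in> {\<lambda>x. sym_part (outer (\<phi> x) (\<psi> x)) |\<phi> \<psi>. \<phi> \<in> Q0_global \<and> \<psi> \<in> RT 1 UNIV}"
      then obtain q d c C h where M: "M = (\<lambda>x. sym_part (outer (q + (\<chi> i. d$i * x$i))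
          (c + C *v x + (h \<bullet> x) *\<^sub>R x)))"
        unfolding Q0_global_def RT_1_eq by blast
      define \<psi> where "\<psi> x = c + C *v x + (h \<bullet> x) *\<^sub>R x" for x
      define \<delta> where "\<delta> = (d$1 - d$2) / 2"
      have "M = (\<lambda>x. sym_part (outer (q + (\<chi> i. d$i * x$i)) (\<psi> x)))"
        by (simp add: M \<psi>_def)
      also have "\<dots> = (\<lambda>x. sym_part (outer (q + ((d$1 + d$2) / 2) *\<^sub>R x) (\<psi> x)))
          + \<delta> *\<^sub>R (\<lambda>x. sym_part (outer (vector [x$1, - x$2]) (\<psi> x)))"
        by (simp add: fun_eq_iff vec_eq_iff forall_2 sym_part_outer \<delta>_def scaleR_fun_def field_simps)
      finally have "M = (\<lambda>x. sym_part (outer (q + ((d$1 + d$2) / 2) *\<^sub>R x) (\<psi> x)))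
          + \<delta> *\<^sub>R (\<lambda>x. sym_part (outer (vector [x$1, - x$2]) (\<psi> x)))" .
      moreover have "(\<lambda>x. sym_part (outer (q + ((d$1 + d$2) / 2) *\<^sub>R x) (\<psi> x))) \<in> X_triangle_global"
        unfolding \<psi>_def by (intro sym_tensorI RT_0I RT_1I)
      moreover obtain N p where "(\<lambda>x. sym_part (outer (vector [x$1, - x$2]) (\<psi> x))) = N + P3_field p"
        "N \<in> X_triangle_global"
        unfolding \<psi>_def sym_tensor_Q0_eq
        by (metis subspace_add[OF subspace_sym_tensor] P1_sym_field_in_X_triangle P2_field_in_X_triangle xxT_field_in_X_triangle)
      ultimately obtain L where "L \<in> X_triangle_global" "N \<in> X_triangle_global" "M = (L + \<delta> *\<^sub>R N) + P3_field (\<delta> *\<^sub>R p)"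
        by (auto simp: scaleR_add_right linear_scale[OF linear_P3_field] add.assoc)
      then show "M \<in> ?R"
        using subspace_add[OF subspace_sym_tensor] subspace_scale[OF subspace_sym_tensor] by blast
    qed
    show "?R \<subseteq> X_square_global"
      using X_triangle_global_subset P3_field_in_X_square by (auto intro!: subspace_add[OF subspace_sym_tensor])
  qed
  fix M N assume M: "M \<in> X_triangle_global" and N: "N \<in> range P3_field" "M + N = 0"
  from M obtain A b d where *: "M = P1_sym_field A + (P2_field b + xxT_field d)"
    using X_triangle_global_direct_sum unfolding is_direct_sum_3 by blast
  moreover obtain p t where **: "N = P3_field (p, t)" using N by auto
  ultimately have "P1_sym_field A + (P2_field b + (P3_field (p, t) + xxT_field d)) = 0"
    using N(2) by (simp add: algebra_simps)
  from fields_independent[OF this] show "M = 0" "N = 0"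
    by (simp_all add: * ** linear_0[OF linear_P1_sym_field] linear_0[OF linear_P2_field]
        linear_0[OF linear_xxT_field] linear_0[OF linear_P3_field] flip: zero_prod_def)
qed

text \<open>The parametrization of the whole space by \<open>9 + 3 + 5 + 3\<close> numbers, from which its dimension is
  read off.\<close>
definition X_square_field :: "(real^3^3) \<times> (real^3) \<times> ((real^3) \<times> (real^2)) \<times> (real^3) \<Rightarrow> real^2 \<Rightarrow> real^2^2" where
  "X_square_field = (\<lambda>(A, b, p, d). P1_sym_field A + (P2_field b + (P3_field p + xxT_field d)))"

lemma linear_X_square_field: "linear X_square_field"
  unfolding X_square_field_def
  by (rule linearI)
    (simp_all add: split_beta linear_add[OF linear_P1_sym_field] linear_add[OF linear_P2_field]
        linear_add[OF linear_xxT_field] linear_scale[OF linear_P1_sym_field] scaleR_add_right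
        linear_scale[OF linear_P2_field] linear_scale[OF linear_xxT_field]
        linear_add[OF linear_P3_field] linear_scale[OF linear_P3_field])

lemma inj_X_square_field: "inj X_square_field"
  unfolding linear_injective_0[OF linear_X_square_field]
  by (auto simp: X_square_field_def zero_prod_def dest: fields_independent)

lemma range_X_square_field: "range X_square_field = X_square_global"
proof (intro equalityI subsetI)
  fix M assume "M \<in> range X_square_field"
  then obtain A b p t d where "M = P1_sym_field A + (P2_field b + (P3_field (p, t) + xxT_field d))"
    by (auto simp: X_square_field_def)
  then show "M \<in> X_square_global"
    using P1_sym_field_in_X_triangle P2_field_in_X_triangle xxT_field_in_X_triangle P3_field_in_X_square X_triangle_global_subset
    by (auto intro!: subspace_add[OF subspace_sym_tensor])
next
  fix M assume "M \<in> X_square_global"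
  then obtain N p where M: "M = N + P3_field p" "N \<in> X_triangle_global"
    using X_square_global_direct_sum unfolding is_direct_sum_2 by blast
  then obtain A b d where "N = P1_sym_field A + (P2_field b + xxT_field d)"
    using X_triangle_global_direct_sum unfolding is_direct_sum_3 by blast
  with M have "M = P1_sym_field A + (P2_field b + xxT_field d) + P3_field p" by simp
  then have "M = X_square_field (A, b, p, d)" by (simp add: X_square_field_def algebra_simps)
  then show "M \<in> range X_square_field" by blast
qed

section \<open>Restriction of spaces of fields\<close>

lemma on_comp: "h 0 = 0 \<Longrightarrow> (\<lambda>x. h (on S f x)) = on S (\<lambda>x. h (f x))"
  by (auto simp: on_def)

lemma Pol_vec_eq_on: "Pol_vec p S = on S ` Pol_vec p UNIV"
proof (intro equalityI subsetI)
  fix \<phi> assume "\<phi> \<in> Pol_vec p S"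
  then have "\<forall>i. \<exists>f\<in>Pol p UNIV. (\<lambda>x. \<phi> x $ i) = on S f"
    unfolding Pol_vec_def Pol_eq_on[of p S] by auto
  then obtain f where f: "\<And>i. f i \<in> Pol p UNIV" "\<And>i. (\<lambda>x. \<phi> x $ i) = on S (f i)" by metis
  have "\<phi> = on S (\<lambda>x. \<chi> i. f i x)"
    using f(2) by (auto simp: on_def fun_eq_iff vec_eq_iff)
  moreover have "(\<lambda>x. \<chi> i. f i x) \<in> Pol_vec p UNIV" using f(1) by (simp add: Pol_vec_def)
  ultimately show "\<phi> \<in> on S ` Pol_vec p UNIV" by blast
next
  fix \<phi> assume "\<phi> \<in> on S ` Pol_vec p UNIV"
  then show "\<phi> \<in> Pol_vec p S"
    unfolding Pol_vec_def Pol_eq_on[of p S] by (auto simp: on_comp[of "\<lambda>v. v $ _"])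
qed

lemma Pol_sym_eq_on: "Pol_sym p S = on S ` Pol_sym p UNIV"
proof (intro equalityI subsetI)
  fix M assume M: "M \<in> Pol_sym p S"
  then have "\<forall>i j. \<exists>f\<in>Pol p UNIV. (\<lambda>x. M x $ i $ j) = on S f"
    unfolding Pol_sym_def Pol_eq_on[of p S] image_iff by simp
  then obtain f where f: "\<And>i j. f i j \<in> Pol p UNIV" "\<And>i j. (\<lambda>x. M x $ i $ j) = on S (f i j)" by metis
  let ?N = "\<lambda>x. symmat (f 1 1 x) (f 1 2 x) (f 2 2 x)"
  have f': "M x $ i $ j = (if x \<in> S then f i j x else 0)" for x i j
    using fun_cong[OF f(2)] by (simp add: on_def)
  have "M x $ 2 $ 1 = M x $ 1 $ 2" for x
    using M by (simp add: Pol_sym_def transpose_def vec_eq_iff)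
  then have "M = on S ?N"
    by (auto simp: on_def fun_eq_iff vec_eq_iff forall_2 f')
  moreover have "?N \<in> Pol_sym p UNIV"
    using f(1) by (simp add: Pol_sym_def forall_2 transpose_def vec_eq_iff)
  ultimately show "M \<in> on S ` Pol_sym p UNIV" by blast
next
  fix M assume "M \<in> on S ` Pol_sym p UNIV"
  then obtain N where N: "M = on S N" "N \<in> Pol_sym p UNIV" by blast
  have "(\<lambda>x. M x $ i $ j) = on S (\<lambda>x. N x $ i $ j)" for i j by (auto simp: N on_def)
  moreover have "transpose (M x) = M x" for x
    using N by (simp add: Pol_sym_def on_def transpose_def vec_eq_iff)
  ultimately show "M \<in> Pol_sym p S"
    using N(2) unfolding Pol_sym_def Pol_eq_on[of p S] by auto
qed

lemma Pol_sym_1_eq: "Pol_sym 1 UNIV = range P1_sym_field"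
proof (intro equalityI subsetI)
  fix M assume M: "M \<in> Pol_sym 1 UNIV"
  then have "\<forall>i j. \<exists>k. (\<lambda>x. M x $ i $ j) = aff k"
    unfolding Pol_sym_def Pol_1_eq image_iff by simp
  then obtain k where "\<And>i j. (\<lambda>x. M x $ i $ j) = aff (k i j)" by metis
  then have k: "M x $ i $ j = aff (k i j) x" for x i j by metis
  have "M x $ 2 $ 1 = M x $ 1 $ 2" for x
    using M by (simp add: Pol_sym_def transpose_def vec_eq_iff)
  then have "M = P1_sym_field (vector [k 1 1, k 1 2, k 2 2])"
    by (simp add: fun_eq_iff vec_eq_iff forall_2 P1_sym_field_def k)
  then show "M \<in> range P1_sym_field" by blast
next
  fix M assume "M \<in> range P1_sym_field"
  then show "M \<in> Pol_sym 1 UNIV"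
    unfolding Pol_sym_def Pol_1_eq by (auto simp: forall_2 P1_sym_field_def transpose_def vec_eq_iff)
qed

lemma RT_eq_on: "RT p S = on S ` RT p UNIV"
proof -
  have eq: "on S \<phi> + (\<lambda>x. on S \<eta> x *\<^sub>R x) = on S (\<phi> + (\<lambda>x. \<eta> x *\<^sub>R x))" for \<phi> and \<eta> :: "real^2 \<Rightarrow> real"
    by (auto simp: on_def)
  have "RT p S = {on S \<phi> + (\<lambda>x. on S \<eta> x *\<^sub>R x) | \<phi> \<eta>. \<phi> \<in> Pol_vec p UNIV \<and> \<eta> \<in> Pol_hom p UNIV}"
    unfolding RT_def Pol_vec_eq_on[of p S] Pol_hom_eq_on[of p S] by blast
  also have "\<dots> = on S ` RT p UNIV"
    unfolding eq RT_def image_Collect_2 ..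
  finally show ?thesis .
qed

lemma xxT_P1_eq_on: "xxT_P1 S = on S ` range xxT_field"
proof -
  have "(\<lambda>x. on S (aff d) x *\<^sub>R outer x x) = on S (xxT_field d)" for d
    by (auto simp: on_def xxT_field_def)
  moreover have "xxT_P1 S = (\<lambda>d x. on S (aff d) x *\<^sub>R outer x x) ` UNIV"
    unfolding xxT_P1_def Pol_eq_on[of 1 S] Pol_1_eq by blast
  ultimately show ?thesis by (simp add: image_image)
qed

lemma sym_tensor_on:
  "sym_space (tensor_space (on S ` X) (on S ` Y)) = on S ` sym_space (tensor_space X Y)"
proof -
  have "{\<lambda>x. sym_part (outer (\<phi> x) (\<psi> x)) |\<phi> \<psi>. \<phi> \<in> on S ` X \<and> \<psi> \<in> on S ` Y}
    = {\<lambda>x. sym_part (outer (on S \<phi> x) (on S \<psi> x)) |\<phi> \<psi>. \<phi> \<in> X \<and> \<psi> \<in> Y}" by blast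
  moreover have "(\<lambda>x. sym_part (outer (on S \<phi> x) (on S \<psi> x))) = on S (\<lambda>x. sym_part (outer (\<phi> x) (\<psi> x)))"
    for \<phi> \<psi> :: "real^2 \<Rightarrow> real^2"
    by (auto simp: on_def fun_eq_iff vec_eq_iff sym_part_outer)
  ultimately show ?thesis
    unfolding sym_tensor_eq_span linear_span_image[OF linear_on, symmetric] image_Collect_2 by simp
qed

lemma inj_on_on_Pol_sym:
  assumes "open S" "S \<noteq> {}"
  shows "inj_on (on S) (Pol_sym p UNIV)"
proof (rule inj_onI)
  fix M N assume M: "M \<in> Pol_sym p UNIV" and N: "N \<in> Pol_sym p UNIV" and eq: "on S M = on S N"
  have "(\<lambda>x. M x $ i $ j) - (\<lambda>x. N x $ i $ j) = 0" for i j
  proof (rule Pol_eq_0_if_eq_0_on_open[OF _ assms])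
    show "(\<lambda>x. M x $ i $ j) - (\<lambda>x. N x $ i $ j) \<in> Pol p UNIV"
      using M N by (intro subspace_diff[OF subspace_Pol]) (auto simp: Pol_sym_def)
    fix x assume "x \<in> S"
    then have "M x = N x" using fun_cong[OF eq, of x] by (simp add: on_def)
    then show "((\<lambda>x. M x $ i $ j) - (\<lambda>x. N x $ i $ j)) x = 0" by simp
  qed
  then show "M = N" by (simp add: fun_eq_iff vec_eq_iff)
qed

section \<open>Piola and Piola--Kirchhoff transformations of global fields\<close>

text \<open>Without a restriction to the parallelogram, the transformations map polynomial fields on the plane
  to polynomial fields on the plane.\<close>
definition piola_global :: "quad \<Rightarrow> (real^2 \<Rightarrow> real^2) \<Rightarrow> real^2 \<Rightarrow> real^2" where
  "piola_global T \<phi> x = (1 / det (B_mat T)) *\<^sub>R (B_mat T *v \<phi> (inv (F_map T) x))"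

definition kirchhoff_global :: "quad \<Rightarrow> (real^2 \<Rightarrow> real^2^2) \<Rightarrow> real^2 \<Rightarrow> real^2^2" where
  "kirchhoff_global T M x = (1 / det (B_mat T)) *\<^sub>R (B_mat T ** M (inv (F_map T) x) ** transpose (B_mat T))"

lemma inv_F_map_in_ref_iff:
  "is_parallelogram T \<Longrightarrow> inv (F_map T) x \<in> region unit_square \<longleftrightarrow> x \<in> region T"
  by (metis bij_F_map bij_inv_eq_iff image_eqI imageE region_eq_F_map)

lemma piola_on:
  "is_parallelogram T \<Longrightarrow> piola T (on (region unit_square) \<phi>) = on (region T) (piola_global T \<phi>)"
  by (auto simp: piola_def piola_global_def on_def fun_eq_iff inv_F_map_in_ref_iff)

lemma piola_kirchhoff_on:
  "is_parallelogram T \<Longrightarrow> piola_kirchhoff T (on (region unit_square) M) = on (region T) (kirchhoff_global T M)"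
  by (auto simp: piola_kirchhoff_def kirchhoff_global_def on_def fun_eq_iff inv_F_map_in_ref_iff)

lemma matrix_inv_B:
  assumes "is_parallelogram T"
  shows "B_mat T ** matrix_inv (B_mat T) = mat 1" "matrix_inv (B_mat T) ** B_mat T = mat 1"
proof -
  have "invertible (B_mat T)" using assms by (simp add: is_parallelogram_def invertible_det_nz)
  then have "\<exists>A'. B_mat T ** A' = mat 1 \<and> A' ** B_mat T = mat 1" by (simp add: invertible_def)
  from someI_ex[OF this] show "B_mat T ** matrix_inv (B_mat T) = mat 1"
    "matrix_inv (B_mat T) ** B_mat T = mat 1"
    by (simp_all add: matrix_inv_def)
qed

lemma inv_F_map:
  assumes "is_parallelogram T"
  shows "inv (F_map T) x = matrix_inv (B_mat T) *v x + - (matrix_inv (B_mat T) *v vert_a T)"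
proof -
  have "F_map T (matrix_inv (B_mat T) *v x + - (matrix_inv (B_mat T) *v vert_a T)) = x"
    by (simp add: F_map_def matrix_vector_mult_diff_distrib matrix_vector_mul_assoc matrix_inv_B[OF assms])
  then show ?thesis using bij_F_map[OF assms] by (metis bij_inv_eq_iff)
qed

lemma RT_1I_linear:
  assumes "linear f" "linear g"
  shows "(\<lambda>x. c + f x + g x *\<^sub>R x) \<in> RT 1 UNIV"
proof -
  have g: "g x = (\<chi> i. g (axis i 1)) \<bullet> x" for x
  proof -
    have "g x = g (\<Sum>i\<in>UNIV. x $ i *\<^sub>R axis i 1)" by (simp add: basis_expansion scalar_mult_eq_scaleR[symmetric])
    also have "\<dots> = (\<Sum>i\<in>UNIV. x $ i *\<^sub>R g (axis i 1))"
      by (simp add: linear_sum[OF assms(2)] linear_scale[OF assms(2)])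
    finally show ?thesis by (simp add: inner_vec_def mult.commute)
  qed
  obtain h where "\<And>x. g x = h \<bullet> x" using g by blast
  then have "(\<lambda>x. c + f x + g x *\<^sub>R x) = (\<lambda>x. c + matrix f *v x + (h \<bullet> x) *\<^sub>R x)"
    by (simp add: fun_eq_iff fun_cong[OF matrix_vector_mul(2)[OF assms(1)]])
  then show ?thesis by (simp only: RT_1I)
qed

text \<open>The assumption says that \<open>C\<close> maps the position vector of the point \<open>D x + e\<close> to \<open>k x\<close> plus a
  constant. Therefore the top-degree part \<open>\<eta> x\<close> keeps its form, and everything else stays of lower
  degree. Both the Piola transformation and its inverse are of this type.\<close>
lemma RT_affine:
  fixes C D :: "real^2^2"
  assumes CD: "\<And>x. C *v (D *v x) = k *\<^sub>R x" and p: "p = 0 \<or> p = 1" and \<phi>: "\<phi> \<in> RT p UNIV"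
  shows "(\<lambda>x. C *v \<phi> (D *v x + e)) \<in> RT p UNIV"
  using p
proof
  assume "p = 0"
  then obtain c a where "\<phi> = (\<lambda>x. c + a *\<^sub>R x)" using \<phi> RT_0_eq by auto
  then have "(\<lambda>x. C *v \<phi> (D *v x + e)) = (\<lambda>x. C *v (c + a *\<^sub>R e) + (a * k) *\<^sub>R x)"
    by (simp add: fun_eq_iff matrix_vector_right_distrib CD scaleR_add_right matrix_vector_mult_scaleR algebra_simps)
  then show ?thesis by (simp only: RT_0I \<open>p = 0\<close>)
next
  assume "p = 1"
  then obtain c A h where \<phi>: "\<phi> = (\<lambda>x. c + A *v x + (h \<bullet> x) *\<^sub>R x)"
    using \<phi> RT_1_eq by auto
  let ?f = "\<lambda>x. C *v (A *v (D *v x)) + (h \<bullet> (D *v x)) *\<^sub>R (C *v e) + (h \<bullet> e * k) *\<^sub>R x"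
  let ?g = "\<lambda>x. k * (h \<bullet> (D *v x))"
  have "(\<lambda>x. C *v \<phi> (D *v x + e))
      = (\<lambda>x. (C *v (c + A *v e + (h \<bullet> e) *\<^sub>R e)) + ?f x + ?g x *\<^sub>R x)"
    by (simp add: \<phi> fun_eq_iff matrix_vector_right_distrib CD scaleR_add_right matrix_vector_mult_scaleR
        inner_add_right algebra_simps)
  moreover have "linear ?f"
    by (rule linearI) (simp_all add: matrix_vector_right_distrib matrix_vector_mult_scaleR inner_add_right algebra_simps)
  moreover have "linear ?g"
    by (rule linearI) (simp_all add: matrix_vector_right_distrib matrix_vector_mult_scaleR inner_add_right algebra_simps)
  ultimately show ?thesis using RT_1I_linear \<open>p = 1\<close> by (simp only:)
qed

lemma piola_global_RT:
  assumes T: "is_parallelogram T" and p: "p = 0 \<or> p = 1"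
  shows "piola_global T ` RT p UNIV = RT p UNIV"
proof (intro equalityI subsetI)
  let ?B = "B_mat T" and ?J = "det (B_mat T)"
  have J: "?J \<noteq> 0" using T by (simp add: is_parallelogram_def)
  have BB: "?B *v (matrix_inv ?B *v x) = x" "matrix_inv ?B *v (?B *v x) = x" for x
    by (simp_all add: matrix_vector_mul_assoc matrix_inv_B[OF T])
  show "\<psi> \<in> RT p UNIV" if \<psi>: "\<psi> \<in> piola_global T ` RT p UNIV" for \<psi>
  proof -
    obtain \<phi> where "\<psi> = piola_global T \<phi>" and \<phi>: "\<phi> \<in> RT p UNIV" using \<psi> by blast
    moreover have "piola_global T \<phi> = (\<lambda>x. ((1 / ?J) *\<^sub>R ?B) *v \<phi> (matrix_inv ?B *v x + - (matrix_inv ?B *v vert_a T)))"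
      by (simp add: piola_global_def[abs_def] inv_F_map[OF T] scaleR_matrix_vector_assoc)
    moreover have "((1 / ?J) *\<^sub>R ?B) *v (matrix_inv ?B *v x) = (1 / ?J) *\<^sub>R x" for x
      by (simp add: BB flip: scaleR_matrix_vector_assoc)
    ultimately show ?thesis using RT_affine[OF _ p \<phi>] by metis
  qed
  fix \<phi> assume \<phi>: "\<phi> \<in> RT p UNIV"
  define \<phi>' where "\<phi>' x = (?J *\<^sub>R matrix_inv ?B) *v \<phi> (?B *v x + vert_a T)" for x
  have "\<phi>' \<in> RT p UNIV"
    unfolding \<phi>'_def
    by (rule RT_affine[OF _ p \<phi>, of _ _ ?J]) (simp add: BB flip: scaleR_matrix_vector_assoc)
  moreover have "\<phi> = piola_global T \<phi>'"
  proof
    fix x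
    have "?B *v inv (F_map T) x + vert_a T = x"
      using bij_F_map[OF T] by (metis F_map_def bij_inv_eq_iff)
    then show "\<phi> x = piola_global T \<phi>' x"
      using J by (simp add: piola_global_def \<phi>'_def BB matrix_vector_mult_scaleR flip: scaleR_matrix_vector_assoc)
  qed
  ultimately show "\<phi> \<in> piola_global T ` RT p UNIV" by blast
qed

lemma matrix_mult_2: "(A ** B) $ i $ j = A $ i $ 1 * B $ 1 $ j + A $ i $ 2 * (B $ 2 $ j)"
  for A B :: "real^2^2"
  by (simp add: matrix_matrix_mult_def sum_2)

lemma linear_kirchhoff_global: "linear (kirchhoff_global T)"
  by (rule linearI)
    (simp_all add: kirchhoff_global_def fun_eq_iff scaleR_fun_def vec_eq_iff matrix_mult_2 field_simps add_divide_distrib)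

lemma kirchhoff_global_eq_0_iff:
  assumes "is_parallelogram T"
  shows "kirchhoff_global T M x = 0 \<longleftrightarrow> M (inv (F_map T) x) = 0"
proof -
  let ?B = "B_mat T" and ?B' = "matrix_inv (B_mat T)" and ?N = "M (inv (F_map T) x)"
  have "?B' ** (?B ** ?N ** transpose ?B) ** transpose ?B' = (?B' ** ?B) ** ?N ** transpose (?B' ** ?B)"
    by (simp add: matrix_transpose_mul matrix_mul_assoc)
  also have "\<dots> = ?N" by (simp add: matrix_inv_B[OF assms] transpose_mat)
  finally have "?B ** ?N ** transpose ?B = 0 \<longleftrightarrow> ?N = 0"
    by (metis times0_left times0_right)
  then show ?thesis using assms by (simp add: kirchhoff_global_def is_parallelogram_def)
qed

lemma inj_kirchhoff_global:
  assumes "is_parallelogram T"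
  shows "inj (kirchhoff_global T)"
  unfolding linear_injective_0[OF linear_kirchhoff_global]
proof (intro allI impI)
  fix M assume "kirchhoff_global T M = 0"
  then have "M (inv (F_map T) (F_map T x)) = 0" for x
    using kirchhoff_global_eq_0_iff[OF assms] by (metis zero_fun_apply)
  then show "M = 0" using bij_F_map[OF assms] by (simp add: fun_eq_iff bij_is_inj)
qed

text \<open>The factor \<open>det B\<close> appears because each Piola transform carries \<open>1 / det B\<close>, whereas the
  Piola--Kirchhoff transform carries it only once.\<close>
lemma kirchhoff_global_outer:
  assumes "is_parallelogram T"
  shows "kirchhoff_global T (\<lambda>x. sym_part (outer (\<phi> x) (\<psi> x))) =
    det (B_mat T) *\<^sub>R (\<lambda>x. sym_part (outer (piola_global T \<phi> x) (piola_global T \<psi> x)))"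
  using assms
  by (simp add: fun_eq_iff vec_eq_iff scaleR_fun_def kirchhoff_global_def piola_global_def sym_part_outer
      matrix_mult_2 matrix_vector_mult_2 transpose_def is_parallelogram_def field_simps)

lemma kirchhoff_global_sym_tensor:
  assumes T: "is_parallelogram T"
  shows "kirchhoff_global T ` sym_space (tensor_space X Y) = sym_space (tensor_space (piola_global T ` X) (piola_global T ` Y))"
proof
  have J: "det (B_mat T) \<noteq> 0" using T by (simp add: is_parallelogram_def)
  show "kirchhoff_global T ` sym_space (tensor_space X Y) \<subseteq> sym_space (tensor_space (piola_global T ` X) (piola_global T ` Y))"
    unfolding sym_tensor_eq_span[of X] linear_span_image[OF linear_kirchhoff_global, symmetric] image_Collect_2
      kirchhoff_global_outer[OF T]
    by (rule span_minimal[OF _ subspace_sym_tensor])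
      (auto intro!: subspace_scale[OF subspace_sym_tensor] sym_tensorI)
  show "sym_space (tensor_space (piola_global T ` X) (piola_global T ` Y)) \<subseteq> kirchhoff_global T ` sym_space (tensor_space X Y)"
    unfolding sym_tensor_eq_span[of "piola_global T ` X"]
  proof (rule span_minimal[OF _ linear_subspace_image[OF linear_kirchhoff_global subspace_sym_tensor]], clarify)
    fix \<phi> \<psi> assume "\<phi> \<in> X" "\<psi> \<in> Y"
    then have "(1 / det (B_mat T)) *\<^sub>R (\<lambda>x. sym_part (outer (\<phi> x) (\<psi> x))) \<in> sym_space (tensor_space X Y)"
      by (intro subspace_scale[OF subspace_sym_tensor] sym_tensorI)
    moreover have "(\<lambda>x. sym_part (outer (piola_global T \<phi> x) (piola_global T \<psi> x))) =
      kirchhoff_global T ((1 / det (B_mat T)) *\<^sub>R (\<lambda>x. sym_part (outer (\<phi> x) (\<psi> x))))"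
      using J by (simp add: linear_scale[OF linear_kirchhoff_global] kirchhoff_global_outer[OF T])
    ultimately show "(\<lambda>x. sym_part (outer (piola_global T \<phi> x) (piola_global T \<psi> x)))
      \<in> kirchhoff_global T ` sym_space (tensor_space X Y)" by blast
  qed
qed

section \<open>The spaces on a parallelogram as restrictions of global spaces\<close>

lemma open_region: "open (region T)"
  by (simp add: region_def)

lemma region_nonempty: "is_parallelogram T \<Longrightarrow> region T \<noteq> {}"
proof -
  assume T: "is_parallelogram T"
  have "vector [1/2, 1/2] \<in> region unit_square" by (simp add: region_unit_square)
  then show ?thesis using region_eq_F_map[OF T] by blast
qed

lemma edge_subset_closure_region:
  assumes T: "is_parallelogram T" and e: "e \<in> edges T"
  shows "edge_set e \<subseteq> closure (region T)"
proof -
  let ?C = "convex hull {vert_a T, vert_b T, vert_d T, vert_c T}"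
  have "closure (region T) = closure ?C"
    using region_nonempty[OF T] unfolding region_def
    by (intro convex_closure_interior convex_convex_hull)
  moreover have "fst e \<in> ?C" "snd e \<in> ?C"
    using e by (auto simp: edges_def intro!: hull_inc)
  then have "edge_set e \<subseteq> ?C"
    unfolding edge_set_def
    by (meson closed_segment_subset convex_convex_hull open_closed_segment subset_eq)
  ultimately show ?thesis using closure_subset by blast
qed

lemma Q0_ref_eq_on: "Q0_ref = on (region unit_square) ` Q0_global"
proof -
  let ?S = "region unit_square"
  let ?g1 = "\<lambda>x::real^2. vector [x$1, 0] :: real^2" and ?g2 = "\<lambda>x::real^2. vector [0, x$2] :: real^2"
  have const: "Pol_vec 0 UNIV = {\<lambda>x. q | q. True}"
  proof (intro equalityI subsetI)
    fix f assume "f \<in> Pol_vec 0 UNIV"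
    then have "f x = f 0" for x
      unfolding Pol_vec_def Pol_0_eq image_iff by simp (metis vec_eq_iff)
    then have "f = (\<lambda>x. f 0)" by blast
    then show "f \<in> {\<lambda>x. q | q. True}" by blast
  qed (auto simp: Pol_vec_def Pol_const)
  have span: "span {on ?S ?g1, on ?S ?g2} = on ?S ` span {?g1, ?g2}"
    using linear_span_image[OF linear_on, of ?S "{?g1, ?g2}"] by simp
  have diag: "span {?g1, ?g2} = {\<lambda>x. \<chi> i. d$i * x$i | d. True}"
  proof (intro equalityI subsetI)
    fix f assume "f \<in> span {?g1, ?g2}"
    then obtain a b where "f = a *\<^sub>R ?g1 + b *\<^sub>R ?g2"
      by (auto simp: span_insert span_singleton algebra_simps)
    then have "f = (\<lambda>x. \<chi> i. vector [a, b] $ i * x$i)"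
      by (simp add: fun_eq_iff vec_eq_iff forall_2 scaleR_fun_def)
    then show "f \<in> {\<lambda>x. \<chi> i. d$i * x$i | d. True}" by blast
  next
    fix f assume "f \<in> {\<lambda>x::real^2. (\<chi> i. d$i * x$i) :: real^2 | d. True}"
    then obtain d where "f = (\<lambda>x. \<chi> i. d$i * x$i)" by blast
    then have "f = d$1 *\<^sub>R ?g1 + d$2 *\<^sub>R ?g2"
      by (simp add: fun_eq_iff vec_eq_iff forall_2 scaleR_fun_def)
    then show "f \<in> span {?g1, ?g2}"
      by (simp only:) (intro span_add span_scale span_base; simp)
  qed
  have "Q0_ref = {on ?S (\<lambda>x. q) + on ?S (\<lambda>x. \<chi> i. d$i * x$i) | q d. True}"
    unfolding Q0_ref_def span diag Pol_vec_eq_on[of 0 ?S] const by blast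
  also have "\<dots> = on ?S ` Q0_global"
    unfolding linear_add[OF linear_on, symmetric] Q0_global_def image_Collect_2 by (simp add: plus_fun_def)
  finally show ?thesis .
qed

lemma P3_tilde_ref_eq_on: "P3_tilde_ref = on (region unit_square) ` range P3_field"
proof -
  let ?g = "[\<lambda>x::real^2. vector [vector [x$1^2, x$1 * x$2], vector [x$1 * x$2, - 2 * x$2^2]],
     \<lambda>x. vector [vector [0, x$2^2], vector [x$2^2, 0]],
     \<lambda>x. vector [vector [0, 0], vector [0, x$1 * x$2]],
     \<lambda>x. vector [vector [2 * x$1^3, - (x$1^2 * x$2)], vector [- (x$1^2 * x$2), - 4 * x$1 * x$2^2]],
     \<lambda>x. vector [vector [4 * x$1^2 * x$2, x$1 * x$2^2], vector [x$1 * x$2^2, - 2 * x$2^3]]]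
    :: (real^2 \<Rightarrow> real^2^2) list"
  have gens: "?g ! 0 = P3_field (vector [1, 0, 0], 0)" "?g ! 1 = P3_field (vector [0, 1, 0], 0)"
    "?g ! 2 = P3_field (vector [0, 0, 1], 0)" "?g ! 3 = P3_field (0, vector [1, 0])"
    "?g ! 4 = P3_field (0, vector [0, 1])"
    by (simp_all add: fun_eq_iff vec_eq_iff forall_2 P3_field_def)
  have "span (set ?g) = range P3_field"
  proof
    show "span (set ?g) \<subseteq> range P3_field"
      using gens by (intro span_minimal subspace_range[OF linear_P3_field]) auto
    show "range P3_field \<subseteq> span (set ?g)"
    proof clarify
      fix p t
      have "P3_field (p, t) = p$1 *\<^sub>R ?g ! 0 + p$2 *\<^sub>R ?g ! 1 + p$3 *\<^sub>R ?g ! 2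
          + t$1 *\<^sub>R ?g ! 3 + t$2 *\<^sub>R ?g ! 4"
        by (simp add: fun_eq_iff vec_eq_iff forall_2 P3_field_def scaleR_fun_def algebra_simps)
      then show "P3_field (p, t) \<in> span (set ?g)"
        by (simp only:) (intro span_add span_scale span_base nth_mem; simp)
    qed
  qed
  then show ?thesis
    unfolding P3_tilde_ref_def linear_span_image[OF linear_on] by simp
qed

lemma X_triangle_eq_on: "X_triangle T = on (region T) ` X_triangle_global"
  unfolding X_triangle_def RT_eq_on[of _ "region T"] sym_tensor_on ..

lemma X_square_eq_on_sym_tensor:
  assumes "is_parallelogram T"
  shows "X_square T = on (region T) ` sym_space (tensor_space (piola_global T ` Q0_global) (RT 1 UNIV))"
proof -
  have "Q0 T = on (region T) ` piola_global T ` Q0_global"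
    unfolding Q0_def Q0_ref_eq_on image_image piola_on[OF assms] ..
  then show ?thesis
    unfolding X_square_def RT_eq_on[of _ "region T"] by (simp only: sym_tensor_on)
qed

lemma X_square_eq_on:
  assumes "is_parallelogram T"
  shows "X_square T = on (region T) ` kirchhoff_global T ` X_square_global"
  unfolding X_square_eq_on_sym_tensor[OF assms] kirchhoff_global_sym_tensor[OF assms]
  by (simp add: piola_global_RT[OF assms])

lemma kirchhoff_global_X_triangle:
  assumes "is_parallelogram T"
  shows "kirchhoff_global T ` X_triangle_global = X_triangle_global"
  unfolding kirchhoff_global_sym_tensor[OF assms] by (simp add: piola_global_RT[OF assms])

lemma on_in: "x \<in> S \<Longrightarrow> on S f x = f x"
  by (simp add: on_def)

lemma axis_nth: "axis k c $ i = (if i = k then c else 0)"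
  by (simp add: axis_def)

section \<open>Directional derivatives, divergences and traces\<close>

lemma dir_deriv_eqI: "((\<lambda>s. f (x + s *\<^sub>R v)) has_real_derivative D) (at 0) \<Longrightarrow> dir_deriv v f x = D"
  by (simp add: dir_deriv_def DERIV_imp_deriv)

lemma dir_deriv_cong_ev:
  assumes "\<forall>\<^sub>F s in nhds 0. f (x + s *\<^sub>R v) = g (x + s *\<^sub>R v)"
  shows "dir_deriv v f x = dir_deriv v g x"
  unfolding dir_deriv_def by (rule deriv_cong_ev[OF assms refl])

lemma dir_deriv_cong_open:
  assumes "open S" "x \<in> S" "\<And>y. y \<in> S \<Longrightarrow> f y = g y"
  shows "dir_deriv v f x = dir_deriv v g x"
proof (rule dir_deriv_cong_ev)
  have "((\<lambda>s. x + s *\<^sub>R v) \<longlongrightarrow> x + 0 *\<^sub>R v) (nhds 0)"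
    by (intro tendsto_intros) (simp add: filterlim_ident)
  then have "\<forall>\<^sub>F s in nhds 0. x + s *\<^sub>R v \<in> S"
    using assms(1,2) by (intro topological_tendstoD) auto
  then show "\<forall>\<^sub>F s in nhds 0. f (x + s *\<^sub>R v) = g (x + s *\<^sub>R v)"
    by eventually_elim (rule assms(3))
qed

lemma P2_tilde_eq_on:
  assumes "open S"
  shows "P2_tilde S = on S ` range P2_field"
proof -
  have d1: "dir_deriv (axis 1 1) (\<lambda>y. quadr b y * y $ i) x
      = (2 * b$1 * x$1 + b$2 * x$2) * x $ i + quadr b x * axis 1 1 $ i" for b x i
    by (rule dir_deriv_eqI)
      (auto simp: quadr_def axis_def power2_eq_square algebra_simps intro!: derivative_eq_intros)
  have d2: "dir_deriv (axis 2 1) (\<lambda>y. quadr b y * y $ i) x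
      = (b$2 * x$1 + 2 * b$3 * x$2) * x $ i + quadr b x * axis 2 1 $ i" for b x i
    by (rule dir_deriv_eqI)
      (auto simp: quadr_def axis_def power2_eq_square algebra_simps intro!: derivative_eq_intros)
  have cong: "dir_deriv v (\<lambda>y. on S (quadr b) y * y $ i) x = dir_deriv v (\<lambda>y. quadr b y * y $ i) x"
    if "x \<in> S" for v b i x
    by (rule dir_deriv_cong_open[OF assms that]) (simp add: on_def)
  have "sCurl S (\<lambda>x. on S (quadr b) x *\<^sub>R x) = on S (P2_field b)" for b
  proof
    fix x
    show "sCurl S (\<lambda>x. on S (quadr b) x *\<^sub>R x) x = on S (P2_field b) x"
    proof (cases "x \<in> S")
      case True
      have C: "Curl S (\<lambda>x. on S (quadr b) x *\<^sub>R x) x = (\<chi> i j.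
          if j = 1 then (b$2 * x$1 + 2 * b$3 * x$2) * x $ i + quadr b x * axis 2 1 $ i
          else - ((2 * b$1 * x$1 + b$2 * x$2) * x $ i + quadr b x * axis 1 1 $ i))"
        using True by (simp add: Curl_def on_in vec_eq_iff cong d1 d2)
      show ?thesis
        by (simp add: True sCurl_def C on_in vec_eq_iff forall_2 sym_part_def transpose_def
            axis_nth P2_field_def power2_eq_square field_simps)
    next
      case False
      then show ?thesis by (simp add: sCurl_def Curl_def on_def linear_0[OF linear_sym_part])
    qed
  qed
  moreover have "P2_tilde S = (\<lambda>b. sCurl S (\<lambda>x. on S (quadr b) x *\<^sub>R x)) ` UNIV"
    unfolding P2_tilde_def Pol_hom_eq_on[of 2 S] Pol_hom_2_eq by blast
  ultimately show ?thesis by (simp add: image_image)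
qed

text \<open>Differential operators are local, so on an open set they commute with the restriction.\<close>
lemma row_div_on:
  assumes "open S"
  shows "row_div S (on S N) = on S (row_div UNIV N)"
proof
  fix x
  have "dir_deriv v (\<lambda>y. on S N y $ i $ j) x = dir_deriv v (\<lambda>y. N y $ i $ j) x" if "x \<in> S" for v i j
    by (rule dir_deriv_cong_open[OF assms that]) (simp add: on_def)
  then show "row_div S (on S N) x = on S (row_div UNIV N) x"
    by (cases "x \<in> S") (auto simp: row_div_def divergence_def on_def vec_eq_iff)
qed

lemma div_div_on:
  assumes "open S"
  shows "div_div S (on S N) = on S (div_div UNIV N)"
proof
  fix x
  have "dir_deriv v (\<lambda>y. on S (row_div UNIV N) y $ i) x = dir_deriv v (\<lambda>y. row_div UNIV N y $ i) x"
    if "x \<in> S" for v i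
    by (rule dir_deriv_cong_open[OF assms that]) (simp add: on_def)
  then show "div_div S (on S N) x = on S (div_div UNIV N) x"
    unfolding div_div_def row_div_on[OF assms]
    by (cases "x \<in> S") (auto simp: divergence_def on_def)
qed

lemma row_div_Pol:
  assumes "N \<in> Pol_sym (Suc p) UNIV"
  shows "(\<lambda>x. row_div UNIV N x $ i) \<in> Pol p UNIV"
  using assms unfolding row_div_def divergence_def
  by (auto simp: Pol_sym_def intro!: Pol_sum Pol_dir_deriv)

lemma div_div_Pol:
  assumes "N \<in> Pol_sym (Suc (Suc p)) UNIV"
  shows "div_div UNIV N \<in> Pol p UNIV"
  using row_div_Pol[OF assms] unfolding div_div_def divergence_def[of UNIV "row_div UNIV N"]
  by (auto intro!: Pol_sum Pol_dir_deriv)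

lemma div_div_xxT_field: "div_div UNIV (xxT_field d) = aff (vector [6 * d$1, 12 * d$2, 12 * d$3])"
proof -
  have 1: "dir_deriv (axis 1 1) (\<lambda>y. xxT_field d y $ i $ 1) x
      = (aff d x + d$2 * x$1) * x$i + aff d x * x$1 * axis 1 1 $ i" for i x
    by (rule dir_deriv_eqI)
      (auto simp: xxT_field_def aff_def axis_def algebra_simps intro!: derivative_eq_intros)
  have 2: "dir_deriv (axis 2 1) (\<lambda>y. xxT_field d y $ i $ 2) x
      = (aff d x + d$3 * x$2) * x$i + aff d x * x$2 * axis 2 1 $ i" for i x
    by (rule dir_deriv_eqI)
      (auto simp: xxT_field_def aff_def axis_def algebra_simps intro!: derivative_eq_intros)
  have "row_div UNIV (xxT_field d) = (\<lambda>x. (3 * d$1 + 4 * d$2 * x$1 + 4 * d$3 * x$2) *\<^sub>R x)"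
    by (simp add: row_div_def divergence_def fun_eq_iff vec_eq_iff forall_2 sum_2 1 2 aff_def axis_nth algebra_simps)
  moreover have "dir_deriv (axis 1 1) (\<lambda>x. (3 * d$1 + 4 * d$2 * x$1 + 4 * d$3 * x$2) * x$1) x
      = 3 * d$1 + 8 * d$2 * x$1 + 4 * d$3 * x$2" for x
    by (rule dir_deriv_eqI) (auto simp: axis_nth algebra_simps intro!: derivative_eq_intros)
  moreover have "dir_deriv (axis 2 1) (\<lambda>x. (3 * d$1 + 4 * d$2 * x$1 + 4 * d$3 * x$2) * x$2) x
      = 3 * d$1 + 4 * d$2 * x$1 + 8 * d$3 * x$2" for x
    by (rule dir_deriv_eqI) (auto simp: axis_nth algebra_simps intro!: derivative_eq_intros)
  ultimately show ?thesis
    by (simp add: div_div_def divergence_def fun_eq_iff sum_2 aff_def)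
qed

text \<open>Every point of the closure of an open set of the plane is a limit point of the set, so the limit
  that defines the trace is unique.\<close>
lemma trace_of_eq:
  assumes "open S" "x \<in> closure S" "\<And>y. y \<in> S \<Longrightarrow> f y = g y" "isCont g x"
  shows "trace_of S f x = g x"
proof -
  have "x islimpt S"
    using assms(1,2) by (metis Diff_empty Diff_insert0 interior_limit_point interior_open islimpt_in_closure)
  then have "at x within S \<noteq> bot" by (simp add: trivial_limit_within)
  moreover have "\<forall>\<^sub>F y in at x within S. g y = f y"
    using assms(3) by (simp add: eventually_at_filter)
  moreover have "(g \<longlongrightarrow> g x) (at x within S)"
    using assms(4) continuous_at_imp_continuous_at_within unfolding continuous_within by blast
  ultimately show ?thesis
    unfolding trace_of_def by (intro tendsto_Lim) (auto dest: Lim_transform_eventually)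
qed

section \<open>Traces on an edge\<close>

text \<open>In reference coordinates the linear part of the field is a diagonal matrix \<open>D\<close>, hence in physical
  coordinates it is \<open>A = B D B^(-1) / det B\<close>, and the columns of \<open>B\<close>, which are the edge vectors of the
  parallelogram, are eigenvectors of \<open>A\<close>.\<close>
lemma piola_Q0_global_eigen:
  assumes T: "is_parallelogram T" and \<phi>: "\<phi> \<in> piola_global T ` Q0_global"
  obtains w A k l where "\<phi> = (\<lambda>x. w + A *v x)"
    "A *v (vert_b T - vert_a T) = k *\<^sub>R (vert_b T - vert_a T)"
    "A *v (vert_c T - vert_a T) = l *\<^sub>R (vert_c T - vert_a T)"
proof -
  let ?B = "B_mat T" and ?B' = "matrix_inv (B_mat T)" and ?J = "det (B_mat T)"
  obtain q d where \<phi>: "\<phi> = piola_global T (\<lambda>x. q + (\<chi> i. d$i * x$i))"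
    using \<phi> unfolding Q0_global_def by blast
  define D :: "real^2^2" where "D = (\<chi> i j. if i = j then d$i else 0)"
  have D: "(\<chi> i. d$i * x$i) = D *v x" for x
    by (simp add: vec_eq_iff forall_2 matrix_vector_mult_2 D_def)
  define A where "A = (1 / ?J) *\<^sub>R (?B ** D ** ?B')"
  have "\<phi> = (\<lambda>x. (1 / ?J) *\<^sub>R (?B *v (q - D *v (?B' *v vert_a T))) + A *v x)"
    by (simp add: \<phi> piola_global_def fun_eq_iff D inv_F_map[OF T] A_def matrix_vector_right_distrib
        matrix_vector_mult_diff_distrib scaleR_add_right scaleR_diff_right matrix_vector_mul_assoc
        matrix_mul_assoc flip: scaleR_matrix_vector_assoc)
  moreover have A: "A *v x = (1 / ?J) *\<^sub>R (?B *v (D *v (?B' *v x)))" for x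
    by (simp add: A_def matrix_vector_mul_assoc matrix_mul_assoc flip: scaleR_matrix_vector_assoc)
  have eigen: "A *v (?B *v axis i 1) = (d$i / ?J) *\<^sub>R (?B *v axis i 1)" for i
  proof -
    have "D *v axis i 1 = d$i *\<^sub>R axis i 1"
      by (simp add: vec_eq_iff forall_2 matrix_vector_mult_2 D_def axis_nth)
    moreover have "?B' *v (?B *v axis i 1) = axis i 1"
      by (simp only: matrix_vector_mul_assoc matrix_inv_B[OF T] matrix_vector_mul_lid)
    ultimately show ?thesis by (simp add: A matrix_vector_mult_scaleR)
  qed
  have "?B *v axis 1 1 = vert_b T - vert_a T" "?B *v axis 2 1 = vert_c T - vert_a T"
    by (simp_all add: B_mat_mult axis_nth)
  with eigen[of 1] eigen[of 2] have "A *v (vert_b T - vert_a T) = (d$1 / ?J) *\<^sub>R (vert_b T - vert_a T)"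
    "A *v (vert_c T - vert_a T) = (d$2 / ?J) *\<^sub>R (vert_c T - vert_a T)"
    by (simp_all only:)
  ultimately show ?thesis by (rule that)
qed

lemma edge_tangent_normal:
  assumes T: "is_parallelogram T" and e: "e \<in> edges T"
  shows "norm (tangent e) = 1" "fst e \<noteq> snd e"
    "\<exists>r. tangent e = r *\<^sub>R (vert_b T - vert_a T) \<or> tangent e = r *\<^sub>R (vert_c T - vert_a T)"
proof -
  let ?u = "vert_b T - vert_a T" and ?v = "vert_c T - vert_a T"
  have det: "?u$1 * ?v$2 - ?v$1 * ?u$2 > 0" and d: "vert_d T - vert_c T = ?u"
    using T by (simp_all add: is_parallelogram_def B_mat_def det_2)
  then have nz: "?u \<noteq> 0" "?v \<noteq> 0" by auto
  have d': "vert_d T - vert_b T = ?v" using d by (simp add: algebra_simps)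
  have "snd e - fst e \<in> {?u, vert_d T - vert_b T, vert_c T - vert_d T, vert_a T - vert_c T}"
    using e unfolding edges_def by auto
  moreover have "vert_c T - vert_d T = - ?u" "vert_a T - vert_c T = - ?v"
    using d by (metis minus_diff_eq, simp)
  ultimately consider "snd e - fst e = 1 *\<^sub>R ?u" | "snd e - fst e = 1 *\<^sub>R ?v"
    | "snd e - fst e = (-1) *\<^sub>R ?u" | "snd e - fst e = (-1) *\<^sub>R ?v"
    by (auto simp only: d' insert_iff empty_iff scaleR_minus1_left scaleR_one)
  then have "\<exists>r. (snd e - fst e = r *\<^sub>R ?u \<or> snd e - fst e = r *\<^sub>R ?v) \<and> r \<noteq> 0"
  proof cases
    case 1 then show ?thesis by (intro exI[of _ 1] conjI disjI1) (assumption, simp)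
  next
    case 2 then show ?thesis by (intro exI[of _ 1] conjI disjI2) (assumption, simp)
  next
    case 3 then show ?thesis by (intro exI[of _ "-1"] conjI disjI1) (assumption, simp)
  next
    case 4 then show ?thesis by (intro exI[of _ "-1"] conjI disjI2) (assumption, simp)
  qed
  then obtain r where r: "snd e - fst e = r *\<^sub>R ?u \<or> snd e - fst e = r *\<^sub>R ?v" "r \<noteq> 0"
    by blast
  have "snd e - fst e \<noteq> 0" using r nz by (elim disjE) simp_all
  then show "fst e \<noteq> snd e" "norm (tangent e) = 1" by (auto simp: tangent_def)
  show "\<exists>r. tangent e = r *\<^sub>R ?u \<or> tangent e = r *\<^sub>R ?v"
  proof (rule exI[of _ "inverse (norm (snd e - fst e)) * r"])
    show "tangent e = (inverse (norm (snd e - fst e)) * r) *\<^sub>R ?u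
        \<or> tangent e = (inverse (norm (snd e - fst e)) * r) *\<^sub>R ?v"
      using r(1) unfolding tangent_def scaleR_scaleR[symmetric] by (elim disjE) (rule disjI1 disjI2, rule arg_cong, assumption)+
  qed
qed

lemma normal_frame:
  assumes "norm (tangent e) = 1"
  shows "normal e \<bullet> tangent e = 0" "x = (tangent e \<bullet> x) *\<^sub>R tangent e + (normal e \<bullet> x) *\<^sub>R normal e"
proof -
  show "normal e \<bullet> tangent e = 0" by (simp add: normal_def inner_vec_def sum_2)
  have 1: "tangent e $ 1 * tangent e $ 1 + tangent e $ 2 * tangent e $ 2 = 1"
    using assms by (simp add: norm_eq_1 inner_vec_def sum_2)
  have "(tangent e \<bullet> x) * tangent e $ 1 + (normal e \<bullet> x) * tangent e $ 2
      = (tangent e $ 1 * tangent e $ 1 + tangent e $ 2 * tangent e $ 2) * x $ 1"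
    "(tangent e \<bullet> x) * tangent e $ 2 - (normal e \<bullet> x) * tangent e $ 1
      = (tangent e $ 1 * tangent e $ 1 + tangent e $ 2 * tangent e $ 2) * x $ 2"
    by (simp_all add: normal_def inner_vec_def sum_2 algebra_simps)
  then show "x = (tangent e \<bullet> x) *\<^sub>R tangent e + (normal e \<bullet> x) *\<^sub>R normal e"
    unfolding 1 by (simp add: vec_eq_iff forall_2 normal_def)
qed

lemma edge_setE:
  assumes "fst e \<noteq> snd e" "x \<in> edge_set e"
  shows "normal e \<bullet> x = normal e \<bullet> fst e" "\<forall>\<^sub>F s in nhds 0. x + s *\<^sub>R tangent e \<in> edge_set e"
proof -
  define l where "l = norm (snd e - fst e)"
  have l: "l > 0" using assms by (simp add: l_def)
  have t: "snd e - fst e = l *\<^sub>R tangent e" using l by (simp add: tangent_def l_def[symmetric])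
  obtain r where r: "0 < r" "r < 1" "x = fst e + (r * l) *\<^sub>R tangent e"
  proof -
    obtain r where "0 < r" "r < 1" "x = (1 - r) *\<^sub>R fst e + r *\<^sub>R snd e"
      using assms by (auto simp: edge_set_def in_segment)
    moreover have "(1 - r) *\<^sub>R fst e + r *\<^sub>R snd e = fst e + r *\<^sub>R (snd e - fst e)"
      by (simp add: algebra_simps)
    ultimately show ?thesis using that t by simp
  qed
  show "normal e \<bullet> x = normal e \<bullet> fst e"
    by (simp add: r(3) inner_add_right) (simp add: normal_def inner_vec_def sum_2)
  have "((\<lambda>s. r + s / l) \<longlongrightarrow> r + 0 / l) (nhds 0)"
    using l by (intro tendsto_intros) (auto simp: filterlim_ident)
  then have "\<forall>\<^sub>F s in nhds 0. r + s / l \<in> {0<..<1}"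
    using r by (intro topological_tendstoD) auto
  then show "\<forall>\<^sub>F s in nhds 0. x + s *\<^sub>R tangent e \<in> edge_set e"
  proof eventually_elim
    case (elim s)
    have "x + s *\<^sub>R tangent e = fst e + (r + s / l) *\<^sub>R (l *\<^sub>R tangent e)"
      using l by (simp add: r(3) algebra_simps)
    also have "\<dots> = (1 - (r + s / l)) *\<^sub>R fst e + (r + s / l) *\<^sub>R snd e"
      unfolding t[symmetric] by (simp add: algebra_simps)
    finally show ?case
      unfolding edge_set_def in_segment using elim assms(1) by auto
  qed
qed

lemma sym_part_outer_bilinear:
  "a \<bullet> (sym_part (outer u v) *v b) = ((a \<bullet> u) * (b \<bullet> v) + (b \<bullet> u) * (a \<bullet> v)) / 2"
  for a b :: "real^2"
  by (simp add: inner_vec_def sum_2 matrix_vector_mult_2 sym_part_outer field_simps)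

lemma dir_deriv_sym_tensor:
  fixes w c h a b v :: "real^2" and A C :: "real^2^2"
  defines "\<phi> \<equiv> \<lambda>x. w + A *v x" and "\<psi> \<equiv> \<lambda>x. c + C *v x + (h \<bullet> x) *\<^sub>R x"
  defines "d\<psi> \<equiv> \<lambda>x v. C *v v + (h \<bullet> v) *\<^sub>R x + (h \<bullet> x) *\<^sub>R v"
  shows "dir_deriv v (\<lambda>y. a \<bullet> (sym_part (outer (\<phi> y) (\<psi> y)) *v b)) x =
    ((a \<bullet> (A *v v)) * (b \<bullet> \<psi> x) + (a \<bullet> \<phi> x) * (b \<bullet> d\<psi> x v)
      + (b \<bullet> (A *v v)) * (a \<bullet> \<psi> x) + (b \<bullet> \<phi> x) * (a \<bullet> d\<psi> x v)) / 2"
proof -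
  have \<phi>: "((\<lambda>s. u \<bullet> \<phi> (x + s *\<^sub>R v)) has_real_derivative u \<bullet> (A *v v)) (at 0)" for u
    unfolding \<phi>_def
    by (auto intro!: derivative_eq_intros simp: inner_add_right matrix_vector_right_distrib matrix_vector_mult_scaleR)
  have \<psi>: "((\<lambda>s. u \<bullet> \<psi> (x + s *\<^sub>R v)) has_real_derivative u \<bullet> d\<psi> x v) (at 0)" for u
    unfolding \<psi>_def d\<psi>_def
    by (auto intro!: derivative_eq_intros simp: inner_add_right matrix_vector_right_distrib matrix_vector_mult_scaleR
        algebra_simps)
  show ?thesis
    unfolding sym_part_outer_bilinear
    by (rule dir_deriv_eqI) (auto intro!: derivative_eq_intros \<phi> \<psi> simp: field_simps)
qed

text \<open>The four groups of terms come from the product rule for the row-wise divergence of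
  \<open>sym (\<phi> \<psi>^T)\<close>: with \<open>D\<psi>\<close> the derivative of \<open>\<psi>\<close>, it is half the sum of \<open>A \<psi>\<close>, \<open>(div \<psi>) \<phi>\<close>,
  \<open>(div \<phi>) \<psi>\<close> and \<open>D\<psi> \<phi>\<close>. In the plane \<open>div \<psi> = trace C + 3 (h \<bullet> x)\<close>.\<close>
lemma normal_row_div_sym_tensor:
  fixes w c h n :: "real^2" and A C :: "real^2^2"
  defines "\<phi> \<equiv> \<lambda>x. w + A *v x" and "\<psi> \<equiv> \<lambda>x. c + C *v x + (h \<bullet> x) *\<^sub>R x"
  shows "n \<bullet> row_div UNIV (\<lambda>y. sym_part (outer (\<phi> y) (\<psi> y))) x =
    (n \<bullet> (A *v \<psi> x) + (n \<bullet> \<phi> x) * (trace C + 3 * (h \<bullet> x)) + trace A * (n \<bullet> \<psi> x)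
      + (n \<bullet> (C *v \<phi> x) + (h \<bullet> \<phi> x) * (n \<bullet> x) + (h \<bullet> x) * (n \<bullet> \<phi> x))) / 2"
proof -
  have nth: "sym_part (outer (\<phi> y) (\<psi> y)) $ i $ j
      = axis i 1 \<bullet> (sym_part (outer (\<phi> y) (\<psi> y)) *v axis j 1)" for y i j
    by (simp add: sym_part_outer_bilinear sym_part_outer inner_axis' )
  have deriv: "dir_deriv v (\<lambda>y. a \<bullet> (sym_part (outer (\<phi> y) (\<psi> y)) *v b)) x =
    ((a \<bullet> (A *v v)) * (b \<bullet> \<psi> x) + (a \<bullet> \<phi> x) * (b \<bullet> (C *v v + (h \<bullet> v) *\<^sub>R x + (h \<bullet> x) *\<^sub>R v))
      + (b \<bullet> (A *v v)) * (a \<bullet> \<psi> x) + (b \<bullet> \<phi> x) * (a \<bullet> (C *v v + (h \<bullet> v) *\<^sub>R x + (h \<bullet> x) *\<^sub>R v))) / 2"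
    for a b v
    unfolding \<phi>_def \<psi>_def by (rule dir_deriv_sym_tensor)
  show ?thesis
    unfolding row_div_def divergence_def on_UNIV nth deriv
    by (simp add: inner_vec_def sum_2 matrix_vector_mult_2 axis_nth trace_def add_divide_distrib[symmetric])
      algebra
qed

lemma Pol_linear_fun: "linear f \<Longrightarrow> f \<in> Pol 1 UNIV" for f :: "real^2 \<Rightarrow> real"
proof -
  assume f: "linear f"
  have eq: "f = (\<lambda>x. f (axis 1 1) * x$1 + f (axis 2 1) * x$2)"
  proof
    fix x :: "real^2"
    have "x = x$1 *\<^sub>R axis 1 1 + x$2 *\<^sub>R axis 2 1" by (simp add: vec_eq_iff forall_2 axis_nth)
    then have "f x = f (x$1 *\<^sub>R axis 1 1 + x$2 *\<^sub>R axis 2 1)" by simp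
    then show "f x = f (axis 1 1) * x$1 + f (axis 2 1) * x$2"
      by (simp add: linear_add[OF f] linear_scale[OF f])
  qed
  show "f \<in> Pol 1 UNIV"
    by (subst eq) (use Pol_coord[of _ 0] in \<open>auto intro!: Pol_add Pol_scale\<close>)
qed

lemma Pol_inner_matrix: "(\<lambda>x. a \<bullet> (A *v x)) \<in> Pol 1 UNIV" for a :: "real^2" and A :: "real^2^2"
  by (rule Pol_linear_fun, rule linearI)
    (simp_all add: matrix_vector_right_distrib matrix_vector_mult_scaleR inner_add_right)

text \<open>In the plane, if \<open>t\<close> is an eigenvector of \<open>A\<close>, then the vector \<open>n\<close> orthogonal to it is an
  eigenvector of the transpose of \<open>A\<close>, because the functional \<open>x \<mapsto> n \<bullet> A x\<close> vanishes on \<open>t\<close>.\<close>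
lemma edge_frame:
  assumes T: "is_parallelogram T" and e: "e \<in> edges T" and \<phi>: "\<phi> \<in> piola_global T ` Q0_global"
  obtains w A k \<mu> where "\<phi> = (\<lambda>x. w + A *v x)" "A *v tangent e = k *\<^sub>R tangent e"
    "\<forall>x. normal e \<bullet> (A *v x) = \<mu> * (normal e \<bullet> x)"
proof -
  obtain w A k l where A: "\<phi> = (\<lambda>x. w + A *v x)"
    "A *v (vert_b T - vert_a T) = k *\<^sub>R (vert_b T - vert_a T)"
    "A *v (vert_c T - vert_a T) = l *\<^sub>R (vert_c T - vert_a T)"
    using piola_Q0_global_eigen[OF T \<phi>] .
  note e' = edge_tangent_normal[OF T e]
  obtain r where r: "tangent e = r *\<^sub>R (vert_b T - vert_a T) \<or> tangent e = r *\<^sub>R (vert_c T - vert_a T)"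
    using e'(3) by blast
  then have "A *v tangent e = k *\<^sub>R tangent e \<or> A *v tangent e = l *\<^sub>R tangent e"
    by (elim disjE) (simp_all only: matrix_vector_mult_scaleR A(2,3) scaleR_scaleR mult.commute simp_thms)
  then obtain k where k: "A *v tangent e = k *\<^sub>R tangent e" by blast
  have "normal e \<bullet> (A *v x) = (normal e \<bullet> (A *v normal e)) * (normal e \<bullet> x)" for x
  proof -
    have "A *v x = A *v ((tangent e \<bullet> x) *\<^sub>R tangent e + (normal e \<bullet> x) *\<^sub>R normal e)"
      by (rule arg_cong) (rule normal_frame(2)[OF e'(1)])
    then show ?thesis
      by (simp add: matrix_vector_right_distrib matrix_vector_mult_scaleR k inner_add_right
          normal_frame(1)[OF e'(1)])
  qed
  then show ?thesis using that A(1) k by blast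
qed

text \<open>Along the edge, \<open>n \<bullet> x = \<kappa>\<close> and \<open>n \<bullet> \<phi> = \<nu>\<close> are constant and \<open>n \<bullet> \<psi>\<close> is the affine function \<open>P\<close>.
  With \<open>n \<bullet> A \<psi> = \<mu> P\<close>, every product in the normal divergence has a constant factor; in particular
  \<open>(h \<bullet> \<phi>) (n \<bullet> x)\<close> and \<open>(h \<bullet> x) (n \<bullet> \<phi>)\<close> are affine. In the tangential derivative,
  \<open>n \<bullet> A t = 0\<close> removes the term with \<open>t \<bullet> \<psi>\<close>, which is quadratic along the edge, and
  \<open>n \<bullet> D\<psi> t\<close> is constant because \<open>n \<bullet> t = 0\<close>.\<close>
lemma edge_trace_generator:
  assumes T: "is_parallelogram T" and e: "e \<in> edges T"
    and \<phi>: "\<phi> \<in> piola_global T ` Q0_global" and \<psi>: "\<psi> \<in> RT 1 UNIV"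
  defines "N \<equiv> \<lambda>x. sym_part (outer (\<phi> x) (\<psi> x))"
  shows "\<exists>g\<in>Pol 1 UNIV. \<forall>x\<in>edge_set e. normal e \<bullet> (N x *v normal e) = g x"
    and "\<exists>g\<in>Pol 1 UNIV. \<forall>x\<in>edge_set e. normal e \<bullet> row_div UNIV N x
      + dir_deriv (tangent e) (\<lambda>y. tangent e \<bullet> (N y *v normal e)) x = g x"
proof -
  let ?n = "normal e" and ?t = "tangent e"
  obtain w A k \<mu> where A: "\<phi> = (\<lambda>x. w + A *v x)" "A *v ?t = k *\<^sub>R ?t"
    "\<forall>x. ?n \<bullet> (A *v x) = \<mu> * (?n \<bullet> x)"
    by (rule edge_frame[OF T e \<phi>])
  obtain c C h where \<psi>: "\<psi> = (\<lambda>x. c + C *v x + (h \<bullet> x) *\<^sub>R x)"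
    using \<psi> RT_1_eq by auto
  note e' = edge_tangent_normal[OF T e]
  have tn: "?n \<bullet> ?t = 0" using normal_frame(1)[OF e'(1)] .
  define \<kappa> where "\<kappa> = ?n \<bullet> fst e"
  define \<nu> where "\<nu> = ?n \<bullet> w + \<mu> * \<kappa>"
  define P where "P x = ?n \<bullet> c + ?n \<bullet> (C *v x) + \<kappa> * (h \<bullet> x)" for x
  have \<kappa>: "?n \<bullet> x = \<kappa>" if "x \<in> edge_set e" for x
    using edge_setE(1)[OF e'(2) that] by (simp add: \<kappa>_def)
  have n\<phi>: "?n \<bullet> \<phi> x = \<nu>" if "x \<in> edge_set e" for x
    by (simp add: A(1,3) inner_add_right \<kappa>[OF that] \<nu>_def)
  have n\<psi>: "?n \<bullet> \<psi> x = P x" if "x \<in> edge_set e" for x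
    by (simp add: \<psi> inner_add_right \<kappa>[OF that] P_def)
  have lin: "(\<lambda>x. v \<bullet> x) \<in> Pol 1 UNIV" for v :: "real^2"
    using Pol_linear[of v 0] by simp
  note intros = Pol_add Pol_const Pol_scale lin Pol_inner_matrix
  have P: "P \<in> Pol 1 UNIV"
    unfolding P_def by (intro intros)
  have "(\<lambda>x. \<nu> * P x) \<in> Pol 1 UNIV" by (intro intros P)
  moreover have "?n \<bullet> (N x *v ?n) = \<nu> * P x" if "x \<in> edge_set e" for x
    by (simp add: N_def sym_part_outer_bilinear n\<phi>[OF that] n\<psi>[OF that])
  ultimately show "\<exists>g\<in>Pol 1 UNIV. \<forall>x\<in>edge_set e. ?n \<bullet> (N x *v ?n) = g x"
    by (intro bexI[of _ "\<lambda>x. \<nu> * P x"]) auto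
  let ?g = "\<lambda>x. (1/2) * (\<mu> * P x + \<nu> * (trace C + 3 * (h \<bullet> x)) + trace A * P x
      + (?n \<bullet> (C *v w) + ?n \<bullet> ((C ** A) *v x) + \<kappa> * (h \<bullet> w + h \<bullet> (A *v x)) + \<nu> * (h \<bullet> x))
      + (k * (?t \<bullet> ?t) * P x + (?n \<bullet> (C *v ?t) + (h \<bullet> ?t) * \<kappa>) * (?t \<bullet> w + ?t \<bullet> (A *v x))
        + \<nu> * (?t \<bullet> (C *v ?t) + (h \<bullet> ?t) * (?t \<bullet> x) + (?t \<bullet> ?t) * (h \<bullet> x))))"
  have "?g \<in> Pol 1 UNIV" by (intro intros P)
  moreover have "?n \<bullet> row_div UNIV N x + dir_deriv ?t (\<lambda>y. ?t \<bullet> (N y *v ?n)) x = ?g x"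
    if x: "x \<in> edge_set e" for x
  proof -
    have div: "?n \<bullet> row_div UNIV N x =
      (\<mu> * P x + \<nu> * (trace C + 3 * (h \<bullet> x)) + trace A * P x
      + (?n \<bullet> (C *v w) + ?n \<bullet> ((C ** A) *v x) + \<kappa> * (h \<bullet> w + h \<bullet> (A *v x)) + \<nu> * (h \<bullet> x))) / 2"
    proof -
      have \<phi>x: "w + A *v x = \<phi> x" and \<psi>x: "c + C *v x + (h \<bullet> x) *\<^sub>R x = \<psi> x"
        by (simp_all add: A(1) \<psi>)
      have "?n \<bullet> (A *v \<psi> x) = \<mu> * P x" using A(3) n\<psi>[OF x] by simp
      moreover have "?n \<bullet> (C *v \<phi> x) = ?n \<bullet> (C *v w) + ?n \<bullet> ((C ** A) *v x)"
        by (simp add: A(1) matrix_vector_right_distrib matrix_vector_mul_assoc inner_add_right)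
      moreover have "h \<bullet> \<phi> x = h \<bullet> w + h \<bullet> (A *v x)" by (simp add: A(1) inner_add_right)
      moreover have "?n \<bullet> row_div UNIV N x = (?n \<bullet> (A *v \<psi> x) + (?n \<bullet> \<phi> x) * (trace C + 3 * (h \<bullet> x))
          + trace A * (?n \<bullet> \<psi> x)
          + (?n \<bullet> (C *v \<phi> x) + (h \<bullet> \<phi> x) * (?n \<bullet> x) + (h \<bullet> x) * (?n \<bullet> \<phi> x))) / 2"
        unfolding \<phi>x[symmetric] \<psi>x[symmetric] normal_row_div_sym_tensor[symmetric]
        by (simp add: N_def A(1) \<psi>)
      ultimately show ?thesis
        by (simp add: n\<phi>[OF x] n\<psi>[OF x] \<kappa>[OF x] algebra_simps)
    qed
    have t: "dir_deriv ?t (\<lambda>y. ?t \<bullet> (N y *v ?n)) x =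
      (k * (?t \<bullet> ?t) * P x + (?n \<bullet> (C *v ?t) + (h \<bullet> ?t) * \<kappa>) * (?t \<bullet> w + ?t \<bullet> (A *v x))
        + \<nu> * (?t \<bullet> (C *v ?t) + (h \<bullet> ?t) * (?t \<bullet> x) + (?t \<bullet> ?t) * (h \<bullet> x))) / 2"
      unfolding N_def A(1) \<psi> dir_deriv_sym_tensor
      using n\<phi>[OF x] n\<psi>[OF x] \<kappa>[OF x]
      by (simp add: A \<psi> tn inner_add_right algebra_simps)
    show ?thesis unfolding div t by (simp add: add_divide_distrib)
  qed
  ultimately show "\<exists>g\<in>Pol 1 UNIV. \<forall>x\<in>edge_set e. ?n \<bullet> row_div UNIV N x
      + dir_deriv ?t (\<lambda>y. ?t \<bullet> (N y *v ?n)) x = g x"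
    by (intro bexI[of _ ?g]) auto
qed

lemma subspace_Pol_sym: "subspace (Pol_sym p UNIV)"
  unfolding subspace_def Pol_sym_def
  by (auto simp: scaleR_fun_def transpose_def vec_eq_iff zero_fun_def intro!: Pol_add Pol_scale Pol_const)

lemma sym_tensor_subset_Pol_sym:
  assumes X: "X \<subseteq> Pol_vec p UNIV" and Y: "Y \<subseteq> Pol_vec q UNIV"
  shows "sym_space (tensor_space X Y) \<subseteq> Pol_sym (p + q) UNIV"
  unfolding sym_tensor_eq_span
proof (rule span_minimal[OF _ subspace_Pol_sym], clarify)
  fix \<phi> \<psi> assume "\<phi> \<in> X" "\<psi> \<in> Y"
  then have "(\<lambda>x. \<phi> x $ i) \<in> Pol p UNIV" "(\<lambda>x. \<psi> x $ i) \<in> Pol q UNIV" for i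
    using X Y unfolding Pol_vec_def by blast+
  then have "(\<lambda>x. (1/2) * (\<phi> x $ i * \<psi> x $ j + \<phi> x $ j * \<psi> x $ i)) \<in> Pol (p + q) UNIV" for i j
    by (intro Pol_scale Pol_add Pol_mult)
  then show "(\<lambda>x. sym_part (outer (\<phi> x) (\<psi> x))) \<in> Pol_sym (p + q) UNIV"
    by (simp add: Pol_sym_def sym_part_outer transpose_def vec_eq_iff add.commute mult.commute)
qed

lemma piola_Q0_global_subset: 
  assumes "is_parallelogram T"
  shows "piola_global T ` Q0_global \<subseteq> Pol_vec 1 UNIV"
proof
  fix \<phi> assume "\<phi> \<in> piola_global T ` Q0_global"
  then obtain w A k l where "\<phi> = (\<lambda>x. w + A *v x)"
    "A *v (vert_b T - vert_a T) = k *\<^sub>R (vert_b T - vert_a T)"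
    "A *v (vert_c T - vert_a T) = l *\<^sub>R (vert_c T - vert_a T)"
    by (rule piola_Q0_global_eigen[OF assms])
  then show "\<phi> \<in> Pol_vec 1 UNIV" unfolding Pol_vec_1_eq by blast
qed

lemma RT_1_subset: "RT 1 UNIV \<subseteq> Pol_vec 2 UNIV"
proof
  fix \<psi> assume "\<psi> \<in> RT 1 UNIV"
  then obtain c C h where \<psi>: "\<psi> = (\<lambda>x. c + C *v x + (h \<bullet> x) *\<^sub>R x)"
    using RT_1_eq by auto
  have "(\<lambda>x. (h \<bullet> x) * x $ i) \<in> Pol 2 UNIV" for i
    using Pol_mult[OF Pol_linear[of h 0] Pol_coord[of i 0]] by (simp add: numeral_2_eq_2)
  moreover have "(\<lambda>x. (C *v x) $ i) \<in> Pol 2 UNIV" for i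
    using Pol_coord[of _ 1] by (auto simp: matrix_vector_mult_2 numeral_2_eq_2 intro!: Pol_add Pol_scale)
  ultimately show "\<psi> \<in> Pol_vec 2 UNIV"
    by (auto simp: Pol_vec_def \<psi> intro!: Pol_add Pol_const)
qed

lemma dir_deriv_add:
  assumes "f \<in> Pol (Suc p) UNIV" "g \<in> Pol (Suc p) UNIV"
  shows "dir_deriv v (\<lambda>x. f x + g x) x = dir_deriv v f x + dir_deriv v g x"
  by (rule dir_deriv_eqI) (intro DERIV_add Pol_dir_deriv(2)[OF assms(1)] Pol_dir_deriv(2)[OF assms(2)])

lemma dir_deriv_scale:
  assumes "f \<in> Pol (Suc p) UNIV"
  shows "dir_deriv v (\<lambda>x. c * f x) x = c * dir_deriv v f x"
  by (rule dir_deriv_eqI) (intro DERIV_cmult Pol_dir_deriv(2)[OF assms(1)])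

lemma row_div_add:
  assumes "M \<in> Pol_sym (Suc p) UNIV" "N \<in> Pol_sym (Suc p) UNIV"
  shows "row_div UNIV (M + N) x = row_div UNIV M x + row_div UNIV N x"
  using assms by (simp add: row_div_def divergence_def vec_eq_iff Pol_sym_def dir_deriv_add[of _ p] sum.distrib)

lemma row_div_scale:
  assumes "M \<in> Pol_sym (Suc p) UNIV"
  shows "row_div UNIV (c *\<^sub>R M) x = c *\<^sub>R row_div UNIV M x"
  using assms by (simp add: row_div_def divergence_def vec_eq_iff Pol_sym_def scaleR_fun_def
      dir_deriv_scale[of _ p] sum_distrib_left)

lemma Pol_bilinear:
  assumes "N \<in> Pol_sym p UNIV"
  shows "(\<lambda>x. a \<bullet> (N x *v b)) \<in> Pol p UNIV"
proof -
  have "(\<lambda>x. \<Sum>i\<in>UNIV. a $ i * (\<Sum>j\<in>UNIV. b $ j * N x $ i $ j)) \<in> Pol p UNIV"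
    using assms by (intro Pol_sum Pol_scale) (simp add: Pol_sym_def)
  then show ?thesis by (simp add: inner_vec_def matrix_vector_mult_def mult.commute)
qed

lemma subspace_agrees_with_Pol:
  assumes V: "subspace V"
    and add: "\<And>M N x. M \<in> V \<Longrightarrow> N \<in> V \<Longrightarrow> L (M + N) x = L M x + (L N x :: real)"
    and scale: "\<And>M c x. M \<in> V \<Longrightarrow> L (c *\<^sub>R M) x = c * L M x"
  shows "subspace {N \<in> V. \<exists>g\<in>Pol p UNIV. \<forall>x\<in>E. L N x = g x}"
  unfolding subspace_def
proof (intro conjI ballI allI)
  have "L 0 x = 0" for x using scale[of 0 0] subspace_0[OF V] by simp
  then show "0 \<in> {N \<in> V. \<exists>g\<in>Pol p UNIV. \<forall>x\<in>E. L N x = g x}"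
    using subspace_0[OF V] Pol_const[of 0 p] by auto
next
  fix M N assume "M \<in> {N \<in> V. \<exists>g\<in>Pol p UNIV. \<forall>x\<in>E. L N x = g x}"
    "N \<in> {N \<in> V. \<exists>g\<in>Pol p UNIV. \<forall>x\<in>E. L N x = g x}"
  then obtain f g where *: "M \<in> V" "N \<in> V" "f \<in> Pol p UNIV" "g \<in> Pol p UNIV"
    "\<And>x. x \<in> E \<Longrightarrow> L M x = f x" "\<And>x. x \<in> E \<Longrightarrow> L N x = g x" by blast
  have "\<forall>x\<in>E. L (M + N) x = f x + g x" using * add by simp
  then show "M + N \<in> {N \<in> V. \<exists>g\<in>Pol p UNIV. \<forall>x\<in>E. L N x = g x}"
    using subspace_add[OF V *(1,2)] Pol_add[OF *(3,4)] by (intro CollectI conjI bexI[of _ "\<lambda>x. f x + g x"])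
next
  fix c M assume "M \<in> {N \<in> V. \<exists>g\<in>Pol p UNIV. \<forall>x\<in>E. L N x = g x}"
  then obtain f where *: "M \<in> V" "f \<in> Pol p UNIV" "\<And>x. x \<in> E \<Longrightarrow> L M x = f x" by blast
  have "\<forall>x\<in>E. L (c *\<^sub>R M) x = c * f x" using * scale by simp
  then show "c *\<^sub>R M \<in> {N \<in> V. \<exists>g\<in>Pol p UNIV. \<forall>x\<in>E. L N x = g x}"
    using subspace_scale[OF V *(1)] Pol_scale[OF *(2)] by (intro CollectI conjI bexI[of _ "\<lambda>x. c * f x"])
qed

text \<open>Both expressions are linear in the tensor field, so the case of a product carries over to the
  span. The ambient space of cubic fields provides the differentiability that linearity needs.\<close>
lemma sym_tensor_edge_traces:
  assumes T: "is_parallelogram T" and e: "e \<in> edges T"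
    and N: "N \<in> sym_space (tensor_space (piola_global T ` Q0_global) (RT 1 UNIV))"
  shows "\<exists>g\<in>Pol 1 UNIV. \<forall>x\<in>edge_set e. normal e \<bullet> (N x *v normal e) = g x"
    and "\<exists>g\<in>Pol 1 UNIV. \<forall>x\<in>edge_set e. normal e \<bullet> row_div UNIV N x
      + dir_deriv (tangent e) (\<lambda>y. tangent e \<bullet> (N y *v normal e)) x = g x"
proof -
  let ?n = "normal e" and ?t = "tangent e"
  let ?L1 = "\<lambda>N x. ?n \<bullet> (N x *v ?n)"
    and ?L2 = "\<lambda>N x. ?n \<bullet> row_div UNIV N x + dir_deriv ?t (\<lambda>y. ?t \<bullet> (N y *v ?n)) x"
  have Pol3: "sym_space (tensor_space (piola_global T ` Q0_global) (RT 1 UNIV)) \<subseteq> Pol_sym (Suc 2) UNIV"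
    using sym_tensor_subset_Pol_sym[OF piola_Q0_global_subset[OF T] RT_1_subset]
    by (simp add: numeral_2_eq_2 numeral_3_eq_3)
  have 1: "subspace {N \<in> Pol_sym (Suc 2) UNIV. \<exists>g\<in>Pol 1 UNIV. \<forall>x\<in>edge_set e. ?L1 N x = g x}"
    by (rule subspace_agrees_with_Pol[OF subspace_Pol_sym])
      (simp_all add: matrix_vector_mult_add_rdistrib inner_add_right scaleR_fun_def flip: scaleR_matrix_vector_assoc)
  have 2: "subspace {N \<in> Pol_sym (Suc 2) UNIV. \<exists>g\<in>Pol 1 UNIV. \<forall>x\<in>edge_set e. ?L2 N x = g x}"
  proof (rule subspace_agrees_with_Pol[OF subspace_Pol_sym])
    fix M N x assume *: "M \<in> Pol_sym (Suc 2) UNIV" "N \<in> Pol_sym (Suc 2) UNIV"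
    show "?L2 (M + N) x = ?L2 M x + ?L2 N x"
      using dir_deriv_add[OF Pol_bilinear[OF *(1), of ?t ?n] Pol_bilinear[OF *(2), of ?t ?n]]
      by (simp add: row_div_add[OF *] matrix_vector_mult_add_rdistrib inner_add_right)
  next
    fix M c x assume *: "M \<in> Pol_sym (Suc 2) UNIV"
    show "?L2 (c *\<^sub>R M) x = c * ?L2 M x"
      using dir_deriv_scale[OF Pol_bilinear[OF *, of ?t ?n]]
      by (simp add: row_div_scale[OF *] fun_cong[OF scaleR_fun_def] distrib_left flip: scaleR_matrix_vector_assoc)
  qed
  have gen: "(\<lambda>x. sym_part (outer (\<phi> x) (\<psi> x))) \<in> Pol_sym (Suc 2) UNIV"
    if "\<phi> \<in> piola_global T ` Q0_global" "\<psi> \<in> RT 1 UNIV" for \<phi> \<psi>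
    using sym_tensorI[OF that] Pol3 by blast
  have "N \<in> {N \<in> Pol_sym (Suc 2) UNIV. \<exists>g\<in>Pol 1 UNIV. \<forall>x\<in>edge_set e. ?L1 N x = g x}"
  proof (rule subsetD[OF _ N], unfold sym_tensor_eq_span, rule span_minimal[OF subsetI 1])
    fix N assume "N \<in> {\<lambda>x. sym_part (outer (\<phi> x) (\<psi> x)) |\<phi> \<psi>. \<phi> \<in> piola_global T ` Q0_global \<and> \<psi> \<in> RT 1 UNIV}"
    then obtain \<phi> \<psi> where *: "N = (\<lambda>x. sym_part (outer (\<phi> x) (\<psi> x)))" "\<phi> \<in> piola_global T ` Q0_global" "\<psi> \<in> RT 1 UNIV"
      by blast
    show "N \<in> {N \<in> Pol_sym (Suc 2) UNIV. \<exists>g\<in>Pol 1 UNIV. \<forall>x\<in>edge_set e. ?L1 N x = g x}"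
      unfolding *(1) using gen[OF *(2,3)] edge_trace_generator(1)[OF T e *(2,3)] by (intro CollectI conjI)
  qed
  then show "\<exists>g\<in>Pol 1 UNIV. \<forall>x\<in>edge_set e. ?L1 N x = g x" by simp
  have "N \<in> {N \<in> Pol_sym (Suc 2) UNIV. \<exists>g\<in>Pol 1 UNIV. \<forall>x\<in>edge_set e. ?L2 N x = g x}"
  proof (rule subsetD[OF _ N], unfold sym_tensor_eq_span, rule span_minimal[OF subsetI 2])
    fix N assume "N \<in> {\<lambda>x. sym_part (outer (\<phi> x) (\<psi> x)) |\<phi> \<psi>. \<phi> \<in> piola_global T ` Q0_global \<and> \<psi> \<in> RT 1 UNIV}"
    then obtain \<phi> \<psi> where *: "N = (\<lambda>x. sym_part (outer (\<phi> x) (\<psi> x)))" "\<phi> \<in> piola_global T ` Q0_global" "\<psi> \<in> RT 1 UNIV"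
      by blast
    show "N \<in> {N \<in> Pol_sym (Suc 2) UNIV. \<exists>g\<in>Pol 1 UNIV. \<forall>x\<in>edge_set e. ?L2 N x = g x}"
      unfolding *(1) using gen[OF *(2,3)] edge_trace_generator(2)[OF T e *(2,3)] by (intro CollectI conjI)
  qed
  then show "\<exists>g\<in>Pol 1 UNIV. \<forall>x\<in>edge_set e. ?L2 N x = g x" by simp
qed

lemma X_square_edge_traces:
  assumes T: "is_parallelogram T" and e: "e \<in> edges T" and M: "M \<in> X_square T"
  shows "on (edge_set e) (trace_of (region T) (\<lambda>y. normal e \<bullet> (M y *v normal e))) \<in> Pol 1 (edge_set e)" (is ?f)
    and "on (edge_set e) (\<lambda>x. trace_of (region T) (\<lambda>y. normal e \<bullet> row_div (region T) M y) x
            + dir_deriv (tangent e) (trace_of (region T) (\<lambda>y. tangent e \<bullet> (M y *v normal e))) x)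
          \<in> Pol 1 (edge_set e)" (is ?g)
proof -
  let ?W = "sym_space (tensor_space (piola_global T ` Q0_global) (RT 1 UNIV))"
  obtain N where MN: "M = on (region T) N" and N: "N \<in> ?W"
    using M unfolding X_square_eq_on_sym_tensor[OF T] by blast
  have N3: "N \<in> Pol_sym (Suc 2) UNIV"
    using N sym_tensor_subset_Pol_sym[OF piola_Q0_global_subset[OF T] RT_1_subset]
    by (auto simp: numeral_2_eq_2 numeral_3_eq_3)
  have tr: "trace_of (region T) (\<lambda>y. a \<bullet> (M y *v b)) x = a \<bullet> (N x *v b)" if "x \<in> edge_set e" for a b x
  proof (rule trace_of_eq[OF open_region])
    show "x \<in> closure (region T)" using that edge_subset_closure_region[OF T e] by blast
    show "isCont (\<lambda>x. a \<bullet> (N x *v b)) x" by (rule Pol_continuous[OF Pol_bilinear[OF N3]])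
  qed (simp add: MN on_in)
  have row: "(\<lambda>y. n \<bullet> row_div UNIV N y) \<in> Pol 2 UNIV" for n
    unfolding inner_vec_def inner_real_def by (intro Pol_sum Pol_scale row_div_Pol[OF N3])
  have tr_div: "trace_of (region T) (\<lambda>y. n \<bullet> row_div (region T) M y) x = n \<bullet> row_div UNIV N x"
    if "x \<in> edge_set e" for n x
  proof (rule trace_of_eq[OF open_region])
    show "x \<in> closure (region T)" using that edge_subset_closure_region[OF T e] by blast
    show "isCont (\<lambda>y. n \<bullet> row_div UNIV N y) x" by (rule Pol_continuous[OF row])
  qed (simp add: MN row_div_on[OF open_region] on_in)
  have tr_t: "dir_deriv (tangent e) (trace_of (region T) (\<lambda>y. a \<bullet> (M y *v b))) x
      = dir_deriv (tangent e) (\<lambda>y. a \<bullet> (N y *v b)) x" if "x \<in> edge_set e" for a b x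
    by (rule dir_deriv_cong_ev, rule eventually_mono[OF edge_setE(2)[OF edge_tangent_normal(2)[OF T e] that]])
      (rule tr)
  obtain g where "g \<in> Pol 1 UNIV" "\<And>x. x \<in> edge_set e \<Longrightarrow> normal e \<bullet> (N x *v normal e) = g x"
    using sym_tensor_edge_traces(1)[OF T e N] by blast
  then have "on (edge_set e) (trace_of (region T) (\<lambda>y. normal e \<bullet> (M y *v normal e))) = on (edge_set e) g"
    by (intro ext) (simp add: on_def tr)
  with \<open>g \<in> Pol 1 UNIV\<close> show ?f unfolding Pol_eq_on[of 1 "edge_set e"] by blast
  obtain g where "g \<in> Pol 1 UNIV" "\<And>x. x \<in> edge_set e \<Longrightarrow> normal e \<bullet> row_div UNIV N x
      + dir_deriv (tangent e) (\<lambda>y. tangent e \<bullet> (N y *v normal e)) x = g x"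
    using sym_tensor_edge_traces(2)[OF T e N] by blast
  then have "on (edge_set e) (\<lambda>x. trace_of (region T) (\<lambda>y. normal e \<bullet> row_div (region T) M y) x
            + dir_deriv (tangent e) (trace_of (region T) (\<lambda>y. tangent e \<bullet> (M y *v normal e))) x)
      = on (edge_set e) g"
    by (intro ext) (simp add: on_def tr_div tr_t)
  with \<open>g \<in> Pol 1 UNIV\<close> show ?g unfolding Pol_eq_on[of 1 "edge_set e"] by blast
qed

section \<open>The tensor space of a parallelogram\<close>

lemma kirchhoff_global_unit_square: "kirchhoff_global unit_square M = M"
proof -
  have "B_mat unit_square = mat 1"
    by (simp add: B_mat_def unit_square_def mat_def vec_eq_iff forall_2)
  then show ?thesis by (simp add: kirchhoff_global_def fun_eq_iff F_map_unit_square transpose_mat)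
qed

lemma X_square_eq_piola_kirchhoff:
  assumes "is_parallelogram T"
  shows "X_square T = piola_kirchhoff T ` X_square unit_square"
  unfolding X_square_eq_on[OF assms] X_square_eq_on[OF is_parallelogram_unit_square]
  by (simp add: image_image kirchhoff_global_unit_square piola_kirchhoff_on[OF assms])

text \<open>The Piola--Kirchhoff transformation forgets the values outside the reference square, so
  injectivity needs fields that vanish there.\<close>
lemma inj_on_piola_kirchhoff:
  assumes T: "is_parallelogram T"
  shows "inj_on (piola_kirchhoff T) {M. \<forall>x. x \<notin> region unit_square \<longrightarrow> M x = 0}"
proof (rule inj_onI, clarify)
  fix M N :: "real^2 \<Rightarrow> real^2^2"
  assume M: "\<forall>x. x \<notin> region unit_square \<longrightarrow> M x = 0" and N: "\<forall>x. x \<notin> region unit_square \<longrightarrow> N x = 0"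
    and eq: "piola_kirchhoff T M = piola_kirchhoff T N"
  have on: "on (region unit_square) M = M" "on (region unit_square) N = N"
    using M N by (auto simp: on_def)
  then have eq: "on (region T) (kirchhoff_global T M) = on (region T) (kirchhoff_global T N)"
    using eq piola_kirchhoff_on[OF T] by metis
  have "M y = N y" if "y \<in> region unit_square" for y
  proof -
    have "F_map T y \<in> region T" using that region_eq_F_map[OF T] by blast
    then have "kirchhoff_global T (M - N) (F_map T y) = 0"
      using fun_cong[OF eq, of "F_map T y"] by (simp add: on_in linear_diff[OF linear_kirchhoff_global])
    then show ?thesis
      using bij_F_map[OF T] by (simp add: kirchhoff_global_eq_0_iff[OF T] bij_is_inj)
  qed
  then show "M = N" using M N by (metis ext)
qed

lemma kirchhoff_X_square_subset:
  assumes "is_parallelogram T"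
  shows "kirchhoff_global T ` X_square_global \<subseteq> Pol_sym 3 UNIV"
  using sym_tensor_subset_Pol_sym[OF piola_Q0_global_subset[OF assms] RT_1_subset]
  unfolding kirchhoff_global_sym_tensor[OF assms]
  by (simp add: piola_global_RT[OF assms] numeral_2_eq_2 numeral_3_eq_3)

theorem proposition7:
  fixes T :: quad
  assumes "is_parallelogram T"
  shows
    "(\<forall>M \<in> sym_fields (region unit_square).
        M \<in> X_square unit_square \<longleftrightarrow> piola_kirchhoff T M \<in> X_square T)
     \<and>
     (is_direct_sum (X_square T) [X_triangle T, piola_kirchhoff T ` P3_tilde_ref] \<and>
      is_direct_sum (X_square T) [Pol_sym 1 (region T), P2_tilde (region T),
        piola_kirchhoff T ` P3_tilde_ref, xxT_P1 (region T)])
     \<and>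
     dim (X_square T) = 20
     \<and>
     (Pol_sym 1 (region T) \<subseteq> X_triangle T \<and> X_triangle T \<subseteq> X_square T \<and>
      X_square T \<subseteq> Pol_sym 3 (region T))
     \<and>
     div_div (region T) ` X_square T = Pol 1 (region T)
     \<and>
     (\<forall>e \<in> edges T. \<forall>M \<in> X_square T.
        on (edge_set e) (trace_of (region T) (\<lambda>y. normal e \<bullet> (M y *v normal e)))
          \<in> Pol 1 (edge_set e))
     \<and>
     (\<forall>e \<in> edges T. \<forall>M \<in> X_square T.
        on (edge_set e) (\<lambda>x.
            trace_of (region T) (\<lambda>y. normal e \<bullet> row_div (region T) M y) x
            + dir_deriv (tangent e)
                (trace_of (region T) (\<lambda>y. tangent e \<bullet> (M y *v normal e))) x)
          \<in> Pol 1 (edge_set e))"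
proof (intro conjI ballI)
  note T = assms
  let ?S = "region T" and ?Sh = "region unit_square" and ?H = "kirchhoff_global T"
  have X: "X_square T = on ?S ` ?H ` X_square_global" by (rule X_square_eq_on[OF T])
  have inj: "inj_on (on ?S) (?H ` X_square_global)"
    by (rule inj_on_subset[OF inj_on_on_Pol_sym[OF open_region region_nonempty[OF T]] kirchhoff_X_square_subset[OF T]])
  have P3: "piola_kirchhoff T ` P3_tilde_ref = on ?S ` ?H ` range P3_field"
    unfolding P3_tilde_ref_eq_on by (simp add: image_image piola_kirchhoff_on[OF T])
  have P1: "Pol_sym 1 ?S = on ?S ` range P1_sym_field"
    using Pol_sym_eq_on[of 1 ?S] by (simp only: Pol_sym_1_eq)
  note P2 = P2_tilde_eq_on[OF open_region, of T]
  have X_triangle_subset: "X_triangle_global \<subseteq> ?H ` X_square_global"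
    using X_triangle_global_subset kirchhoff_global_X_triangle[OF T] by blast

  have sum2: "is_direct_sum (?H ` X_square_global) [X_triangle_global, ?H ` range P3_field]"
    using is_direct_sum_image[OF X_square_global_direct_sum linear_kirchhoff_global inj_on_subset[OF inj_kirchhoff_global[OF T] subset_UNIV]]
    by (simp only: list.map kirchhoff_global_X_triangle[OF T])
  have sum4: "is_direct_sum (?H ` X_square_global)
      [range P1_sym_field, range P2_field, ?H ` range P3_field, range xxT_field]"
    by (rule is_direct_sum_refine[OF sum2 X_triangle_global_direct_sum])
  show "is_direct_sum (X_square T) [X_triangle T, piola_kirchhoff T ` P3_tilde_ref]"
    using is_direct_sum_image[OF sum2 linear_on inj] by (simp only: list.map X P3 X_triangle_eq_on)
  show "is_direct_sum (X_square T) [Pol_sym 1 ?S, P2_tilde ?S, piola_kirchhoff T ` P3_tilde_ref, xxT_P1 ?S]"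
    using is_direct_sum_image[OF sum4 linear_on inj] by (simp only: list.map X P3 P1 P2 xxT_P1_eq_on)

  show "dim (X_square T) = 20"
  proof -
    let ?f = "on ?S \<circ> ?H \<circ> X_square_field"
    have "linear ?f"
      by (intro linear_compose linear_on linear_kirchhoff_global linear_X_square_field)
    moreover have "inj_on (on ?S \<circ> ?H) (range X_square_field)"
      unfolding range_X_square_field by (rule comp_inj_on[OF inj_on_subset[OF inj_kirchhoff_global[OF T] subset_UNIV] inj])
    then have "inj ?f" by (rule comp_inj_on[OF inj_X_square_field])
    moreover have "range ?f = X_square T"
      unfolding X range_X_square_field[symmetric] by (simp add: image_comp comp_assoc)
    ultimately have "dim (X_square T) = DIM((real^3^3) \<times> (real^3) \<times> ((real^3) \<times> (real^2)) \<times> (real^3))"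
      using dim_range_linear by metis
    then show ?thesis by simp
  qed

  show "Pol_sym 1 ?S \<subseteq> X_triangle T"
    unfolding P1 X_triangle_eq_on using P1_sym_field_in_X_triangle by blast
  show "X_triangle T \<subseteq> X_square T"
    unfolding X X_triangle_eq_on using X_triangle_subset by (rule image_mono)
  show "X_square T \<subseteq> Pol_sym 3 ?S"
    unfolding X Pol_sym_eq_on[of 3 ?S] using kirchhoff_X_square_subset[OF T] by (rule image_mono)

  have "div_div UNIV ` ?H ` X_square_global = Pol 1 UNIV"
  proof
    show "div_div UNIV ` ?H ` X_square_global \<subseteq> Pol 1 UNIV"
      using kirchhoff_X_square_subset[OF T] div_div_Pol[of _ 1] by (auto simp: numeral_3_eq_3)
    show "Pol 1 UNIV \<subseteq> div_div UNIV ` ?H ` X_square_global"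
    proof
      fix f assume "f \<in> Pol 1 UNIV"
      then obtain k where "f = aff k" unfolding Pol_1_eq by blast
      (* The divisors invert the action of div div on the fields x x^T (a + b x + c y). *)
      then have "f = div_div UNIV (xxT_field (vector [k$1 / 6, k$2 / 12, k$3 / 12]))"
        by (simp add: div_div_xxT_field aff_def fun_eq_iff)
      then show "f \<in> div_div UNIV ` ?H ` X_square_global" using xxT_field_in_X_triangle X_triangle_subset by blast
    qed
  qed
  moreover have "div_div ?S ` on ?S ` V = on ?S ` div_div UNIV ` V" for V
    by (simp only: image_image div_div_on[OF open_region])
  ultimately show "div_div ?S ` X_square T = Pol 1 ?S"
    unfolding X Pol_eq_on[of 1 ?S] by (simp only:)

  fix M assume M: "M \<in> sym_fields ?Sh"
  have supp: "N \<in> {M. \<forall>x. x \<notin> ?Sh \<longrightarrow> M x = 0}" if "N \<in> X_square unit_square" for N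
    using that unfolding X_square_eq_on[OF is_parallelogram_unit_square] by (auto simp: on_def)
  show "M \<in> X_square unit_square \<longleftrightarrow> piola_kirchhoff T M \<in> X_square T"
    unfolding X_square_eq_piola_kirchhoff[OF T]
    using inj_on_image_mem_iff[OF inj_on_piola_kirchhoff[OF T], of M "X_square unit_square"] M supp
    by (auto simp: sym_fields_def)
qed (use X_square_edge_traces[OF assms] in blast)+

end
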